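(* Let $\mathbb F_q$ be a finite field of characteristic $p$ and let $A\in\mathcal M_{r,n}(\mathbb Z)$ be a matrix of rank $k$. Let $QAP=D$ be a Smith normal form of $A$, with $Q\in\mathcal M_r(\mathbb Z)$ and $P=(p_{ij})\in\mathcal M_n(\mathbb Z)$ invertible over $\mathbb Z$ and $D$ diagonal (with its non-zero entries in the first $k$ diagonal positions), and let $P_1$ and $P_0$ be the submatrices consisting of the first $k$ and last $n-k$ columns of $P$. Let $\Delta$ be the convex hull in $\mathbb R^{n-k}$ of the rows of $P_0$ and the origin. Suppose that for every face $\tau$ of $\Delta$ that does not contain the origin, the reduction modulo $p$ of $P_{0,\tau}$ has rank $\dim(\tau)+1$, where $P_{0,\tau}$ is the submatrix of $P_0$ formed by the rows lying in $\tau$. Then there exists a dense open subset $U\subseteq\mathbb G_m^n$ such that (1) the Laurent polynomial $f_{\mathbf a}(\mathbf x)=\sum_{i=1}^n a_i\prod_{j=k+1}^n x_j^{p_{ij}}$ is non-degenerate with respect to $\Delta$ for every $\mathbf a=(a_1,\dots,a_n)\in U(\overline{\mathbb F_q})$; (2) $V:=[P_1]^{-1}(U)$ is non-empty (so a dense open subset of $\mathbb G_m^k$).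
   Context: $\mathbb G_m^n=\mathbb G_{m,\mathbb F_q}^n$. $[P_1]:\mathbb G_m^k\to\mathbb G_m^n$ is the torus homomorphism $(s_1,\dots,s_k)\mapsto(\prod_{j=1}^k s_j^{p_{1j}},\dots,\prod_{j=1}^k s_j^{p_{nj}})$. Non-degeneracy: for a face $\tau$ of $\Delta$ let $I_\tau\subseteq\{1,\dots,n\}$ be the set of indices $i$ such that the $i$-th row of $P_0$ lies in $\tau$. The Laurent polynomial $f_{\mathbf a}$ (in variables $x_{k+1},\dots,x_n$) is non-degenerate with respect to $\Delta$ if for every face $\tau$ of $\Delta$ not containing the origin, the partial derivatives with respect to $x_{k+1},\dots,x_n$ of $f_{\mathbf a,\tau}(\mathbf x)=\sum_{i\in I_\tau}a_i\prod_{j=k+1}^n x_j^{p_{ij}}$ have no common zero $(x_{k+1},\dots,x_n)\in(\overline{\mathbb F_q}^\times)^{n-k}$. (If $k=n$, $\Delta=\{0\}$ and there are no such faces, so the conditions are vacuous.) *)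

theory Defs
  imports
    "HOL-Analysis.Polytope"
    "HOL-Analysis.Finite_Function_Topology"
    "HOL-Algebra.Algebraic_Closure_Type"
    "Jordan_Normal_Form.DL_Rank"
    "Jordan_Normal_Form.DL_Submatrix"
begin

section \<open>Integer matrices\<close>

text \<open>All indices start at 0, so the first \<open>k\<close> columns are those with index \<open>< k\<close>.\<close>

definition mat_rank :: "'a::field mat \<Rightarrow> nat" where
  "mat_rank M = vec_space.rank (dim_row M) M"

text \<open>The sign of the diagonal entries is not normalised.\<close>

definition is_smith_normal_form :: "int mat \<Rightarrow> bool" where
  "is_smith_normal_form D \<longleftrightarrow> diagonal_mat D \<and>
     (\<forall>i. i + 1 < min (dim_row D) (dim_col D) \<longrightarrow> D $$ (i, i) dvd D $$ (i + 1, i + 1))"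

definition first_cols :: "nat \<Rightarrow> 'a mat \<Rightarrow> 'a mat" where
  "first_cols k P = mat (dim_row P) k (\<lambda>(i, j). P $$ (i, j))"

definition drop_cols :: "nat \<Rightarrow> 'a mat \<Rightarrow> 'a mat" where
  "drop_cols k P = mat (dim_row P) (dim_col P - k) (\<lambda>(i, j). P $$ (i, k + j))"


section \<open>Laurent polynomials\<close>

text \<open>
  A Laurent polynomial is a finitely supported function on exponents, multiplied by convolution;
  an exponent is a finitely supported function from variable indices to the integers.
\<close>

type_synonym 'a laurent = "(nat \<Rightarrow>\<^sub>0 int) \<Rightarrow>\<^sub>0 'a"

definition exponent_of_vec :: "int vec \<Rightarrow> (nat \<Rightarrow>\<^sub>0 int)" where
  "exponent_of_vec v = Poly_Mapping.nth (list_of_vec v)"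

text \<open>The ring of Laurent polynomials in the variables with index \<open>< n\<close>.\<close>

definition laurent_ring :: "nat \<Rightarrow> 'a::comm_ring_1 laurent ring" where
  "laurent_ring n =
     \<lparr>carrier = {f. \<forall>m \<in> Poly_Mapping.keys f. Poly_Mapping.keys m \<subseteq> {..<n}},
      monoid.mult = (*), one = 1, ring.zero = 0, add = (+)\<rparr>"

definition laurent_eval :: "'a::field vec \<Rightarrow> 'a laurent \<Rightarrow> 'a" where
  "laurent_eval x f =
     (\<Sum>m \<in> Poly_Mapping.keys f. Poly_Mapping.lookup f m *
        (\<Prod>j<dim_vec x. vec_index x j powi Poly_Mapping.lookup m j))"

definition laurent_deriv :: "nat \<Rightarrow> 'a::comm_ring_1 laurent \<Rightarrow> 'a laurent" where
  "laurent_deriv j f =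
     (\<Sum>m \<in> Poly_Mapping.keys f.
        Poly_Mapping.single (m - Poly_Mapping.single j 1)
          (of_int (Poly_Mapping.lookup m j) * Poly_Mapping.lookup f m))"


section \<open>Split tori as schemes\<close>

text \<open>
  The torus of dimension \<open>n\<close> over a field is the spectrum of \<open>laurent_ring n\<close>.  The basic open
  sets below form a basis, hence generate the Zariski topology.
\<close>

definition prime_spectrum :: "('a, 'b) ring_scheme \<Rightarrow> 'a set set" where
  "prime_spectrum R = {I. primeideal I R}"

definition zariski_topology :: "('a, 'b) ring_scheme \<Rightarrow> 'a set topology" where
  "zariski_topology R =
     topology_generated_by {{I \<in> prime_spectrum R. f \<notin> I} | f. f \<in> carrier R}"

definition torus :: "nat \<Rightarrow> 'a::field laurent set topology" where
  "torus n = zariski_topology (laurent_ring n)"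

definition dense_openin :: "'a topology \<Rightarrow> 'a set \<Rightarrow> bool" where
  "dense_openin T U \<longleftrightarrow> openin T U \<and> T closure_of U = topspace T"

definition torus_points :: "nat \<Rightarrow> 'a::field vec set" where
  "torus_points n = {x \<in> carrier_vec n. \<forall>i<n. vec_index x i \<noteq> 0}"

text \<open>The point of the scheme underlying the geometric point \<open>a\<close>.\<close>

definition geometric_point_ideal :: "'a::field alg_closure vec \<Rightarrow> 'a laurent set" where
  "geometric_point_ideal a =
     {f \<in> carrier (laurent_ring (dim_vec a)). laurent_eval a (Poly_Mapping.map to_ac f) = 0}"

text \<open>The set \<open>U(K)\<close> for \<open>K\<close> the algebraic closure of the base field.\<close>

definition geometric_points :: "nat \<Rightarrow> 'a::field laurent set set \<Rightarrow> 'a alg_closure vec set" where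
  "geometric_points n U = {a \<in> torus_points n. geometric_point_ideal a \<in> U}"

text \<open>
  For \<open>M\<close> of size \<open>n \<times> k\<close>, the ring homomorphism \<open>x\<^sub>i \<mapsto> \<Prod>j. s\<^sub>j ^ M\<^sub>i\<^sub>j\<close>, which sends the
  monomial with exponent \<open>m\<close> to the one with exponent \<open>M\<^sup>T m\<close>, and the map of spectra it induces.
\<close>

definition torus_comorphism :: "int mat \<Rightarrow> 'a::comm_ring_1 laurent \<Rightarrow> 'a laurent" where
  "torus_comorphism M f =
     (\<Sum>m \<in> Poly_Mapping.keys f.
        Poly_Mapping.single
          (exponent_of_vec (transpose_mat M *\<^sub>v vec (dim_row M) (Poly_Mapping.lookup m)))
          (Poly_Mapping.lookup f m))"

definition torus_hom :: "int mat \<Rightarrow> 'a::comm_ring_1 laurent set \<Rightarrow> 'a laurent set" where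
  "torus_hom M I = {f \<in> carrier (laurent_ring (dim_row M)). torus_comorphism M f \<in> I}"


section \<open>The polytope and non-degeneracy\<close>

text \<open>
  The space \<open>\<real>\<^sup>m\<close>, for arbitrary \<open>m \<ge> 0\<close>, is the subspace of \<open>nat \<Rightarrow>\<^sub>0 real\<close> of functions
  supported on \<open>{..<m}\<close>.
\<close>

definition row_point :: "int mat \<Rightarrow> nat \<Rightarrow> (nat \<Rightarrow>\<^sub>0 real)" where
  "row_point M i = Poly_Mapping.nth (list_of_vec (map_vec real_of_int (row M i)))"

definition row_polytope :: "int mat \<Rightarrow> (nat \<Rightarrow>\<^sub>0 real) set" where
  "row_polytope M = convex hull (insert 0 (row_point M ` {..<dim_row M}))"

text \<open>The empty set satisfies \<open>face_of\<close>, but is not counted as a face here.\<close>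

definition faces_off_origin :: "'a::real_vector set \<Rightarrow> 'a set set" where
  "faces_off_origin \<Delta> = {\<tau>. \<tau> face_of \<Delta> \<and> \<tau> \<noteq> {} \<and> 0 \<notin> \<tau>}"

text \<open>
  The dimension of the affine hull of a non-empty set; \<open>aff_dim\<close> is only available on Euclidean
  spaces.
\<close>

definition affine_dimension :: "'a::real_vector set \<Rightarrow> nat" where
  "affine_dimension S = dim {x - y | x y. x \<in> S \<and> y \<in> S}"

lemma affine_dimension_eq_aff_dim:
  fixes S :: "'a::euclidean_space set"
  assumes "S \<noteq> {}"
  shows "int (affine_dimension S) = aff_dim S"
proof -
  obtain a where a: "a \<in> S" using assms by auto
  have 1: "aff_dim S = int (dim ((\<lambda>x. - a + x) ` S))"
    by (rule aff_dim_eq_dim) (rule hull_inc[OF a])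
  have "span {x - y | x y. x \<in> S \<and> y \<in> S} = span ((\<lambda>x. - a + x) ` S)"
  proof (rule span_eq[THEN iffD2], intro conjI subsetI)
    fix z assume "z \<in> {x - y | x y. x \<in> S \<and> y \<in> S}"
    then obtain x y where z: "z = (- a + x) - (- a + y)" "x \<in> S" "y \<in> S" by auto
    show "z \<in> span ((\<lambda>x. - a + x) ` S)"
      unfolding z(1) by (intro span_diff span_base) (use z in auto)
  next
    fix z assume "z \<in> (\<lambda>x. - a + x) ` S"
    then obtain x where x: "x \<in> S" "z = x - a" by auto
    show "z \<in> span {x - y | x y. x \<in> S \<and> y \<in> S}"
      by (intro span_base) (use a x in blast)
  qed
  from span_eq_dim[OF this] show ?thesis
    unfolding 1 affine_dimension_def by (rule arg_cong)
qed

definition rows_in :: "int mat \<Rightarrow> (nat \<Rightarrow>\<^sub>0 real) set \<Rightarrow> nat set" where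
  "rows_in M \<tau> = {i. i < dim_row M \<and> row_point M i \<in> \<tau>}"

definition face_laurent ::
    "int mat \<Rightarrow> 'a::comm_ring_1 vec \<Rightarrow> (nat \<Rightarrow>\<^sub>0 real) set \<Rightarrow> 'a laurent" where
  "face_laurent M a \<tau> =
     (\<Sum>i \<in> rows_in M \<tau>. Poly_Mapping.single (exponent_of_vec (row M i)) (vec_index a i))"

text \<open>
  Non-degeneracy of \<open>\<Sum>i. a\<^sub>i x ^ (row M i)\<close> with respect to \<open>\<Delta>\<close>; the field \<open>'a\<close> is meant to be
  algebraically closed.
\<close>

definition nondegenerate ::
    "int mat \<Rightarrow> (nat \<Rightarrow>\<^sub>0 real) set \<Rightarrow> 'a::field vec \<Rightarrow> bool" where
  "nondegenerate M \<Delta> a \<longleftrightarrow>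
     (\<forall>\<tau> \<in> faces_off_origin \<Delta>.
        \<not> (\<exists>x \<in> torus_points (dim_col M).
             \<forall>j<dim_col M. laurent_eval x (laurent_deriv j (face_laurent M a \<tau>)) = 0))"

end

theory Submission
  imports Defs "HOL-Library.Function_Algebras"
begin

text \<open>
  Fix a face \<open>\<tau>\<close> off the origin, let \<open>r\<^sub>i\<close> for \<open>i \<in> I\<close> be the rows lying in \<open>\<tau>\<close>, and let
  \<open>d = dim \<tau> + 1\<close>.  A coefficient vector \<open>a\<close> is degenerate at \<open>\<tau>\<close> when for some torus point
  \<open>x\<close> the vector \<open>z = (a\<^sub>i x\<^bsup>r\<^sub>i\<^esup>)\<close> lies in the left kernel of the face matrix modulo \<open>p\<close>.
  By the rank hypothesis this kernel has dimension \<open>\<bar>I\<bar> - d\<close>: over the base field, the coordinates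
  of \<open>z\<close> are linear forms in at most \<open>\<bar>I\<bar> - d\<close> of them (\<open>left_kernel_parametrization\<close>).

  Monomials in \<open>a\<close> with a common weight \<open>w = \<Sum>\<^sub>i m\<^sub>i r\<^sub>i\<close> see \<open>x\<close> only through a common factor, because
  \<open>z\<^sup>m = a\<^sup>m x\<^sup>w\<close>.  So a linear relation over the base field between the functions \<open>z\<^sup>m\<close> on the
  kernel, with all \<open>m\<close> of the same weight, is an equation in \<open>a\<close> alone that every degenerate
  \<open>a\<close> satisfies.

  Such a relation exists by counting.  The rows span a real space of dimension at most \<open>d\<close>, so \<open>d\<close>
  coordinates determine a weight (\<open>ex_separating_coordinates\<close>), and among the \<open>(B + 1)\<^bsup>\<bar>I\<bar>\<^esup>\<close>
  exponents with entries up to \<open>B\<close> some weight is attained at least \<open>c B\<^bsup>\<bar>I\<bar> - d\<^esup>\<close> times, with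
  \<open>c > 0\<close> independent of \<open>B\<close> (\<open>ex_large_fibre\<close>).  Since \<open>\<tau>\<close> misses the origin, the weight also
  determines the total degree (\<open>sum_zero_of_relation_on_face\<close>).  Hence all these \<open>z\<^sup>m\<close> are forms of
  one degree, at most \<open>B \<bar>I\<bar>\<close>, in \<open>\<bar>I\<bar> - d\<close> variables, and such forms only span a space of dimension
  \<open>O(B\<^bsup>\<bar>I\<bar> - d - 1\<^esup>)\<close>.  (If \<open>\<bar>I\<bar> = d\<close> the kernel is zero and no \<open>a\<close> is degenerate
  at \<open>\<tau>\<close>.)  The rank hypothesis and the position of the face thus gain the one dimension that
  makes the degenerate set proper.

  The equation \<open>h\<close> so obtained is isobaric, and this is why its non-vanishing locus meets the image of
  \<open>[P\<^sub>1]\<close>.  The comorphism of \<open>[P\<^sub>1]\<close> sends the monomial with exponent \<open>m\<close> to the one with exponent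
  \<open>P\<^sub>1\<^sup>T m\<close>; as \<open>P\<^sub>0\<^sup>T m = w\<close> is constant and \<open>P\<close> is invertible, different monomials of \<open>h\<close> have
  different images and nothing cancels.  For \<open>U\<close> take the primes that contain none of the
  finitely many \<open>h\<close>.  The generic point lies in \<open>U\<close> and in its preimage, and both are dense since a
  Laurent polynomial ring over a field is a domain.
\<close>

section \<open>Linear dependence and pigeonholes\<close>

text \<open>
  Stated for families rather than sets, because the functions to which it is applied need not be
  pairwise distinct: a repeated value already gives a relation.
\<close>

lemma (in vector_space) dependent_family:
  assumes "finite F" "finite G" "card G < card F" "f ` F \<subseteq> span G"
  shows "\<exists>c. (\<exists>m\<in>F. c m \<noteq> 0) \<and> (\<Sum>m\<in>F. scale (c m) (f m)) = 0"
proof (cases "inj_on f F")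
  case True
  have "dependent (f ` F)"
    using independent_span_bound[OF assms(2) _ assms(4)] assms(3) card_image[OF True] by auto
  then obtain u where u: "\<exists>v\<in>f ` F. u v \<noteq> 0" "(\<Sum>v\<in>f ` F. scale (u v) v) = 0"
    using dependent_finite[of "f ` F"] assms(1) by auto
  have "(\<Sum>m\<in>F. scale (u (f m)) (f m)) = 0"
    using u(2) by (simp add: sum.reindex[OF True])
  with u(1) show ?thesis by (intro exI[of _ "u \<circ> f"]) auto
next
  case False
  then obtain a b where ab: "a \<in> F" "b \<in> F" "a \<noteq> b" "f a = f b" by (auto simp: inj_on_def)
  define c where "c m = (if m = a then 1 else if m = b then - 1 else 0 :: 'a)" for m
  have "(\<Sum>m\<in>F. scale (c m) (f m)) = (\<Sum>m\<in>{a, b}. scale (c m) (f m))"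
    by (rule sum.mono_neutral_right) (use ab assms(1) in \<open>auto simp: c_def\<close>)
  also have "\<dots> = 0" using ab by (simp add: c_def)
  finally show ?thesis using ab by (intro exI[of _ c]) (auto simp: c_def)
qed

text \<open>
  The \<open>(B + 1)\<^bsup>card I\<^esup>\<close> exponents in the box have at most \<open>(2 R B + 1)\<^bsup>card C\<^esup>\<close> different
  weights on \<open>C\<close>, so some weight is attained about \<open>B\<^bsup>card I - card C\<^esup>\<close> times.  The exponent of \<open>B\<close>
  is then at least \<open>e\<close>, whereas \<open>(B * card I + 1) ^ (e - 1)\<close>, which is going to bound the number of
  monomials of one degree in \<open>e\<close> variables, only grows like \<open>B\<^bsup>e - 1\<^esup>\<close>.
\<close>

lemma ex_large_fibre:
  fixes p :: "'i \<Rightarrow> 'j \<Rightarrow> int"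
  assumes "finite I" "finite C" "card C + e \<le> card I" "0 < e"
  shows "\<exists>B F w. F \<subseteq> I \<rightarrow>\<^sub>E {..B::nat} \<and> (B * card I + 1) ^ (e - 1) < card F \<and>
    (\<forall>m\<in>F. \<forall>j\<in>C. (\<Sum>i\<in>I. int (m i) * p i j) = w j)"
proof -
  define R where "R = (\<Sum>i\<in>I. \<Sum>j\<in>C. nat \<bar>p i j\<bar>)"
  define T where "T = 2 * R + card I + 1"
  \<comment> \<open>\<open>T (B + 1)\<close> bounds both counts, and the choice of \<open>B\<close> makes \<open>T ^ (card I - 1)\<close> less than \<open>B + 1\<close>.\<close>
  define B where "B = T ^ (card I - 1)"
  define A where "A = I \<rightarrow>\<^sub>E {..B}"
  define Y where "Y = C \<rightarrow>\<^sub>E {- int (R * B)..int (R * B)}"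
  define \<Phi> where "\<Phi> m = (\<lambda>j\<in>C. \<Sum>i\<in>I. int (m i) * p i j)" for m :: "'i \<Rightarrow> nat"
  have I: "card I \<noteq> 0" using assms by auto
  have cA: "card A = (B + 1) ^ card I" unfolding A_def using assms(1) by (subst card_PiE) auto
  have cY: "card Y = (2 * R * B + 1) ^ card C"
    unfolding Y_def using assms(2) by (subst card_PiE) (auto simp: algebra_simps nat_add_distrib nat_mult_distrib)
  have \<Phi>: "\<Phi> m \<in> Y" if "m \<in> A" for m
  proof -
    have "\<bar>\<Sum>i\<in>I. int (m i) * p i j\<bar> \<le> int (R * B)" if j: "j \<in> C" for j
    proof -
      have "\<bar>\<Sum>i\<in>I. int (m i) * p i j\<bar> \<le> (\<Sum>i\<in>I. \<bar>int (m i) * p i j\<bar>)" by (rule sum_abs)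
      also have "\<dots> \<le> (\<Sum>i\<in>I. int B * int (\<Sum>j\<in>C. nat \<bar>p i j\<bar>))"
      proof (rule sum_mono)
        fix i assume i: "i \<in> I"
        have "nat \<bar>p i j\<bar> \<le> (\<Sum>j\<in>C. nat \<bar>p i j\<bar>)"
          using j assms(2) by (intro member_le_sum) auto
        moreover have "m i \<le> B" using \<open>m \<in> A\<close> i by (auto simp: A_def)
        ultimately have "int (m i) * int (nat \<bar>p i j\<bar>) \<le> int B * int (\<Sum>j\<in>C. nat \<bar>p i j\<bar>)"
          by (intro mult_mono) (simp_all only: of_nat_le_iff of_nat_0_le_iff)
        then show "\<bar>int (m i) * p i j\<bar> \<le> int B * int (\<Sum>j\<in>C. nat \<bar>p i j\<bar>)"
          by (simp add: abs_mult)
      qed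
      also have "\<dots> = int (R * B)" by (simp add: R_def sum_distrib_left mult.commute)
      finally show ?thesis .
    qed
    then show ?thesis by (auto simp: \<Phi>_def Y_def abs_le_iff minus_le_iff)
  qed
  have fY: "finite Y" unfolding Y_def using assms(2) by (intro finite_PiE) auto
  have fA: "finite A" unfolding A_def using assms(1) by (intro finite_PiE) auto
  have "Y \<noteq> {}" unfolding Y_def by (auto simp: PiE_eq_empty_iff)
  then obtain w where w: "w \<in> Y" "card A \<le> card (\<Phi> -` {w} \<inter> A) * card Y"
    using pigeonhole_card[of \<Phi> A Y] \<Phi> fA fY by auto
  define F where "F = \<Phi> -` {w} \<inter> A"
  have "(B * card I + 1) ^ (e - 1) < card F"
  proof (rule ccontr)
    assume "\<not> ?thesis"
    then have "(B + 1) ^ card I \<le> (B * card I + 1) ^ (e - 1) * (2 * R * B + 1) ^ card C"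
      using w(2) cA cY by (smt (verit) F_def le_trans linorder_not_less mult_le_mono1)
    also have "\<dots> \<le> (T * (B + 1)) ^ (e - 1) * (T * (B + 1)) ^ card C"
      by (intro mult_mono power_mono) (auto simp: T_def algebra_simps)
    also have "\<dots> = (T * (B + 1)) ^ (e - 1 + card C)" by (simp add: power_add)
    also have "\<dots> \<le> (T * (B + 1)) ^ (card I - 1)"
      by (rule power_increasing) (use assms in \<open>auto simp: T_def\<close>)
    also have "\<dots> = B * (B + 1) ^ (card I - 1)" by (simp only: power_mult_distrib B_def)
    also have "\<dots> < (B + 1) * (B + 1) ^ (card I - 1)" by simp
    also have "\<dots> = (B + 1) ^ card I" using I by (metis power_eq_if)
    finally show False by simp
  qed
  moreover have "(\<Sum>i\<in>I. int (m i) * p i j) = w j" if "m \<in> F" "j \<in> C" for m j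
    using that by (auto simp: F_def \<Phi>_def)
  ultimately show ?thesis by (intro exI[of _ B] exI[of _ F] exI[of _ w]) (auto simp: F_def A_def)
qed

section \<open>Monomials in linear forms\<close>

text \<open>
  Functions with values in the algebraic closure, viewed as a vector space over the base field: the
  equations to be found must have coefficients in the base field.
\<close>

abbreviation ac_scale :: "'q::field \<Rightarrow> ('x \<Rightarrow> 'q alg_closure) \<Rightarrow> ('x \<Rightarrow> 'q alg_closure)" where
  "ac_scale c f \<equiv> (\<lambda>x. to_ac c * f x)"

interpretation ac_fun: vector_space "ac_scale :: 'q::field \<Rightarrow> ('x \<Rightarrow> 'q alg_closure) \<Rightarrow> _"
  by unfold_locales (auto simp: fun_eq_iff algebra_simps)

text \<open>
  Monomials are taken as functions, so that a relation between them can be read off pointwise.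
\<close>

definition monomials :: "nat set \<Rightarrow> nat \<Rightarrow> ((nat \<Rightarrow> 'q::field alg_closure) \<Rightarrow> 'q alg_closure) set" where
  "monomials J g = (\<lambda>\<alpha> z. \<Prod>j\<in>J. z j ^ \<alpha> j) ` {\<alpha>. (\<Sum>j\<in>J. \<alpha> j) = g}"

text \<open>
  The degree fixes one exponent in terms of the others, so only \<open>card J - 1\<close> of them are free, each
  at most \<open>g\<close>.
\<close>

lemma monomials_bound:
  assumes "finite J" "J \<noteq> {}"
  shows "finite (monomials J g :: ((nat \<Rightarrow> 'q::field alg_closure) \<Rightarrow> _) set)"
    and "card (monomials J g :: ((nat \<Rightarrow> 'q::field alg_closure) \<Rightarrow> _) set) \<le> (g + 1) ^ (card J - 1)"
proof -
  obtain j0 where j0: "j0 \<in> J" using assms by auto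
  define A where "A = (J - {j0}) \<rightarrow>\<^sub>E {..g}"
  define \<Psi> :: "(nat \<Rightarrow> nat) \<Rightarrow> (nat \<Rightarrow> 'q alg_closure) \<Rightarrow> 'q alg_closure"
    where "\<Psi> \<alpha> z = (\<Prod>j\<in>J - {j0}. z j ^ \<alpha> j) * z j0 ^ (g - (\<Sum>j\<in>J - {j0}. \<alpha> j))" for \<alpha> z
  have fA: "finite A" unfolding A_def using assms by (intro finite_PiE) auto
  have cA: "card A = (g + 1) ^ (card J - 1)"
    unfolding A_def using assms j0 by (subst card_PiE) auto
  have sub: "monomials J g \<subseteq> \<Psi> ` A"
  proof
    fix f :: "(nat \<Rightarrow> 'q alg_closure) \<Rightarrow> 'q alg_closure"
    assume "f \<in> monomials J g"
    then obtain \<alpha> where \<alpha>: "(\<Sum>j\<in>J. \<alpha> j) = g" "f = (\<lambda>z. \<Prod>j\<in>J. z j ^ \<alpha> j)"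
      by (auto simp: monomials_def)
    have s: "\<alpha> j0 + (\<Sum>j\<in>J - {j0}. \<alpha> j) = g"
      using sum.remove[OF assms(1) j0, of \<alpha>] \<alpha>(1) by simp
    have "\<alpha> j \<le> g" if "j \<in> J" for j
      using member_le_sum[of j J \<alpha>] that assms \<alpha>(1) by auto
    then have "restrict \<alpha> (J - {j0}) \<in> A" by (auto simp: A_def)
    moreover have "f = \<Psi> (restrict \<alpha> (J - {j0}))"
      using s by (auto simp: fun_eq_iff \<alpha>(2) \<Psi>_def prod.remove[OF assms(1) j0] mult.commute)
    ultimately show "f \<in> \<Psi> ` A" by blast
  qed
  show "finite (monomials J g :: ((nat \<Rightarrow> 'q alg_closure) \<Rightarrow> _) set)"
    using finite_subset[OF sub] fA by blast
  show "card (monomials J g :: ((nat \<Rightarrow> 'q alg_closure) \<Rightarrow> _) set) \<le> (g + 1) ^ (card J - 1)"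
    using card_mono[OF _ sub] card_image_le[OF fA, of \<Psi>] fA cA by fastforce
qed

lemma sum_fun_apply: "(\<Sum>i\<in>A. f i) x = (\<Sum>i\<in>A. f i x)"
  for f :: "'i \<Rightarrow> 'x \<Rightarrow> 'a::comm_monoid_add"
  by (induction A rule: infinite_finite_induct) auto

lemma span_monomials_mult_linear:
  fixes \<beta> :: "nat \<Rightarrow> 'q::field"
  assumes "finite J" "f \<in> ac_fun.span (monomials J g)"
  shows "(\<lambda>z. f z * (\<Sum>j\<in>J. to_ac (\<beta> j) * z j)) \<in> ac_fun.span (monomials J (Suc g))"
proof -
  have mono: "(\<lambda>z. f z * z j) \<in> ac_fun.span (monomials J (Suc g))" if j: "j \<in> J" for j
    using assms(2)
  proof (induction rule: ac_fun.span_induct)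
    case base
    show ?case
    proof (intro ac_fun.subspaceI; clarsimp)
      show "(\<lambda>z::nat \<Rightarrow> 'q alg_closure. 0) \<in> ac_fun.span (monomials J (Suc g))"
        using ac_fun.span_zero[of "monomials J (Suc g)"] by (simp add: zero_fun_def)
    next
      fix x y :: "(nat \<Rightarrow> 'q alg_closure) \<Rightarrow> 'q alg_closure"
      assume "(\<lambda>z. x z * z j) \<in> ac_fun.span (monomials J (Suc g))"
        "(\<lambda>z. y z * z j) \<in> ac_fun.span (monomials J (Suc g))"
      from ac_fun.span_add[OF this]
      show "(\<lambda>z. (x z + y z) * z j) \<in> ac_fun.span (monomials J (Suc g))"
        by (simp add: algebra_simps plus_fun_def)
    next
      fix c :: 'q and x :: "(nat \<Rightarrow> 'q alg_closure) \<Rightarrow> 'q alg_closure"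
      assume "(\<lambda>z. x z * z j) \<in> ac_fun.span (monomials J (Suc g))"
      from ac_fun.span_scale[OF this, of c]
      show "(\<lambda>z. to_ac c * x z * z j) \<in> ac_fun.span (monomials J (Suc g))"
        by (simp add: mult.assoc)
    qed
  next
    case (step x)
    then obtain \<alpha> where \<alpha>: "(\<Sum>j\<in>J. \<alpha> j) = g" "x = (\<lambda>z. \<Prod>j\<in>J. z j ^ \<alpha> j)"
      by (auto simp: monomials_def)
    define \<alpha>' where "\<alpha>' = \<alpha>(j := Suc (\<alpha> j))"
    have 1: "(\<Sum>j\<in>J. \<alpha>' j) = Suc g"
      using \<alpha>(1) by (simp add: sum.remove[OF assms(1) j] \<alpha>'_def)
    have 2: "(\<lambda>z::nat \<Rightarrow> 'q alg_closure. x z * z j) = (\<lambda>z. \<Prod>j\<in>J. z j ^ \<alpha>' j)"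
      by (simp add: fun_eq_iff \<alpha>(2) prod.remove[OF assms(1) j] \<alpha>'_def mult_ac)
    show ?case
      unfolding 2 by (rule ac_fun.span_base) (use 1 in \<open>auto simp: monomials_def\<close>)
  qed
  have "(\<Sum>j\<in>J. ac_scale (\<beta> j) (\<lambda>z. f z * z j)) \<in> ac_fun.span (monomials J (Suc g))"
    by (intro ac_fun.span_sum ac_fun.span_scale mono)
  also have "(\<Sum>j\<in>J. ac_scale (\<beta> j) (\<lambda>z. f z * z j)) = (\<lambda>z. f z * (\<Sum>j\<in>J. to_ac (\<beta> j) * z j))"
    by (simp add: fun_eq_iff sum_distrib_left sum_fun_apply mult_ac)
  finally show ?thesis .
qed

text \<open>
  Expanding a product of linear forms with coefficients in the base field gives a form of the
  expected degree with coefficients in the base field.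
\<close>

lemma prod_linear_in_span_monomials:
  fixes \<beta> :: "'i \<Rightarrow> nat \<Rightarrow> 'q::field"
  assumes "finite J" "finite I"
  shows "(\<lambda>z. \<Prod>i\<in>I. (\<Sum>j\<in>J. to_ac (\<beta> i j) * z j) ^ m i)
     \<in> ac_fun.span (monomials J (\<Sum>i\<in>I. m i))"
  using assms(2)
proof induction
  case empty
  have "(\<lambda>z::nat \<Rightarrow> 'q alg_closure. 1) \<in> monomials J 0"
    using assms(1) by (auto simp: monomials_def image_iff intro!: exI[of _ "\<lambda>_. 0"])
  then show ?case by (auto intro: ac_fun.span_base)
next
  case (insert i I)
  have "(\<lambda>z. (\<Prod>i\<in>I. (\<Sum>j\<in>J. to_ac (\<beta> i j) * z j) ^ m i) * (\<Sum>j\<in>J. to_ac (\<beta> i j) * z j) ^ k)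
     \<in> ac_fun.span (monomials J ((\<Sum>i\<in>I. m i) + k))" for k
  proof (induction k)
    case 0
    then show ?case using insert.IH by simp
  next
    case (Suc k)
    from span_monomials_mult_linear[OF assms(1) this, of "\<beta> i"]
    show ?case by (simp add: mult_ac)
  qed
  from this[of "m i"] show ?case using insert.hyps by (simp add: mult_ac add_ac)
qed

section \<open>Left kernels of matrices\<close>

interpretation fun_space: vector_space "\<lambda>(c::'q::field) (f::'x \<Rightarrow> 'q) x. c * f x"
  by unfold_locales (auto simp: fun_eq_iff algebra_simps)

text \<open>
  Extend independent columns of \<open>M\<close>, as many as the rank, to a basis of the space of all columns of length
  \<open>m\<close> by unit vectors \<open>e\<^sub>j\<close>, \<open>j \<in> J\<close>.  A vector \<open>z\<close> in the left kernel is orthogonal to the columns, so pairing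
  \<open>z\<close> with the expansion of \<open>e\<^sub>i\<close> in this basis expresses \<open>z\<^sub>i\<close> by the \<open>z\<^sub>j\<close>.  The
  basis is defined over the base field, hence so are the coefficients, although \<open>z\<close> is geometric.
\<close>

lemma left_kernel_parametrization:
  fixes M :: "'q::field mat"
  assumes M: "M \<in> carrier_mat m N"
  shows "\<exists>J \<beta>. J \<subseteq> {..<m} \<and> card J + mat_rank M \<le> m \<and>
    (\<forall>z. (\<forall>l<N. (\<Sum>s<m. z s * to_ac (M $$ (s, l))) = 0) \<longrightarrow>
        (\<forall>i<m. z i = (\<Sum>j\<in>J. to_ac (\<beta> i j) * z j)))"
proof -
  interpret V: vec_space "TYPE('q)" m .
  obtain S where S: "maximal S (\<lambda>T. T \<subseteq> set (cols M) \<and> V.lin_indpt T)"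
    using maximal_exists_superset[of "set (cols M)" "\<lambda>T. T \<subseteq> set (cols M) \<and> V.lin_indpt T" "{}"]
    by (auto simp: V.lin_dep_def)
  have rank: "mat_rank M = card S"
    using V.rank_card_indpt[OF M S] M by (simp add: mat_rank_def)
  have Scols: "S \<subseteq> set (cols M)" and indpt: "V.lin_indpt S" using S by (auto simp: maximal_def)
  have fS: "finite S" using Scols finite_subset by blast
  have Scar: "S \<subseteq> carrier_vec m" using Scols M cols_dim by blast
  define \<phi> where "\<phi> v = (\<lambda>i. if i < m then v $ i else 0)" for v :: "'q Matrix.vec"
  define e where "e j = (\<lambda>i. if i = j then 1 else 0 :: 'q)" for j :: nat
  have inj: "inj_on \<phi> S"
  proof (rule inj_onI)
    fix v w assume vw: "v \<in> S" "w \<in> S" "\<phi> v = \<phi> w"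
    have "v $ i = w $ i" if "i < m" for i using fun_cong[OF vw(3), of i] that by (simp add: \<phi>_def)
    moreover have "dim_vec v = m" "dim_vec w = m" using vw(1,2) Scar by (auto dest: subsetD)
    ultimately show "v = w" by (intro eq_vecI) auto
  qed
  have ind: "fun_space.independent (\<phi> ` S)"
  proof
    assume "fun_space.dependent (\<phi> ` S)"
    then obtain u where u: "\<exists>v\<in>S. u (\<phi> v) \<noteq> 0"
      and 0: "(\<Sum>v\<in>S. (\<lambda>i. u (\<phi> v) * \<phi> v i)) = 0"
      using fS by (auto simp: fun_space.dependent_finite sum.reindex[OF inj])
    have "V.lincomb (u \<circ> \<phi>) S = 0\<^sub>v m"
    proof (rule eq_vecI)
      fix i assume "i < dim_vec (0\<^sub>v m :: 'q Matrix.vec)"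
      then have i: "i < m" by simp
      have "V.lincomb (u \<circ> \<phi>) S $ i = (\<Sum>v\<in>S. u (\<phi> v) * v $ i)"
        using V.lincomb_index[OF i Scar] by simp
      also have "\<dots> = (\<Sum>v\<in>S. (\<lambda>i. u (\<phi> v) * \<phi> v i)) i"
        using i by (simp add: sum_fun_apply \<phi>_def)
      finally show "V.lincomb (u \<circ> \<phi>) S $ i = 0\<^sub>v m $ i" using i 0 by simp
    qed (use V.lincomb_dim[OF fS Scar] in simp)
    then have "V.lin_dep S"
      unfolding V.lin_dep_def using u fS by (auto intro!: exI[of _ S] exI[of _ "u \<circ> \<phi>"] simp: class_field_def)
    with indpt show False by blast
  qed
  obtain B where B: "\<phi> ` S \<subseteq> B" "B \<subseteq> \<phi> ` S \<union> e ` {..<m}" "fun_space.independent B"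
    "\<phi> ` S \<union> e ` {..<m} \<subseteq> fun_space.span B"
    using fun_space.maximal_independent_subset_extend[of "\<phi> ` S" "\<phi> ` S \<union> e ` {..<m}"] ind by blast
  have phi_e: "\<phi> v = (\<Sum>j<m. (\<lambda>i. v $ j * e j i))" for v
    by (auto simp: fun_eq_iff sum_fun_apply e_def \<phi>_def if_distrib sum.delta cong: if_cong)
  have "\<phi> v \<in> fun_space.span (e ` {..<m})" for v
    unfolding phi_e by (intro fun_space.span_sum fun_space.span_scale fun_space.span_base) auto
  then have "B \<subseteq> fun_space.span (e ` {..<m})" using B(2) by (auto intro: fun_space.span_base)
  from fun_space.independent_span_bound[OF _ B(3) this]
  have fB: "finite B" and cB: "card B \<le> card (e ` {..<m})" by auto
  have "card B \<le> m" using cB card_image_le[of "{..<m}" e] by simp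
  define J where "J = {j. j < m \<and> e j \<in> B - \<phi> ` S}"
  have inje: "inj_on e J" by (auto simp: inj_on_def e_def fun_eq_iff)
  have Bdec: "B = \<phi> ` S \<union> e ` J" using B(1,2) by (auto simp: J_def)
  have disj: "\<phi> ` S \<inter> e ` J = {}"
  proof -
    have "f \<notin> \<phi> ` S" if f: "f \<in> e ` J" for f
    proof -
      obtain j where j: "f = e j" "j \<in> J" using f by (rule imageE)
      from j(2) have "j < m \<and> e j \<in> B - \<phi> ` S" unfolding J_def by (rule CollectD)
      then have "e j \<in> B - \<phi> ` S" by (rule conjunct2)
      then show ?thesis unfolding j(1) by (rule Diff_iff[THEN iffD1, THEN conjunct2])
    qed
    then show ?thesis by (meson disjoint_iff)
  qed
  have fJ: "finite J" by (simp add: J_def)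
  have "card B = card (\<phi> ` S) + card (e ` J)"
    unfolding Bdec using fS fJ disj by (intro card_Un_disjoint) auto
  then have cJ: "card J + mat_rank M \<le> m"
    using \<open>card B \<le> m\<close> by (simp add: rank card_image inj inje)
  have "\<exists>\<gamma>. \<forall>s. e i s = (\<Sum>v\<in>S. \<gamma> (\<phi> v) * \<phi> v s) + (\<Sum>j\<in>J. \<gamma> (e j) * e j s)" if "i < m" for i
  proof -
    have "e i \<in> fun_space.span B" using B(4) that by auto
    then obtain \<gamma> where "e i = (\<Sum>b\<in>B. (\<lambda>s. \<gamma> b * b s))"
      using fun_space.span_finite[OF fB] by auto
    also have "\<dots> = (\<Sum>b\<in>\<phi> ` S. (\<lambda>s. \<gamma> b * b s)) + (\<Sum>b\<in>e ` J. (\<lambda>s. \<gamma> b * b s))"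
      unfolding Bdec using fS fJ disj by (intro sum.union_disjoint) auto
    finally show ?thesis
      by (intro exI[of _ \<gamma>]) (simp add: sum.reindex inj inje sum_fun_apply)
  qed
  then obtain \<gamma> where \<gamma>: "\<And>i s. i < m \<Longrightarrow>
      e i s = (\<Sum>v\<in>S. \<gamma> i (\<phi> v) * \<phi> v s) + (\<Sum>j\<in>J. \<gamma> i (e j) * e j s)" by metis
  show ?thesis
  proof (intro exI conjI allI impI)
    show "J \<subseteq> {..<m}" "card J + mat_rank M \<le> m" using cJ by (auto simp: J_def)
    fix z :: "nat \<Rightarrow> 'q alg_closure" and i
    assume z: "\<forall>l<N. (\<Sum>s<m. z s * to_ac (M $$ (s, l))) = 0" and i: "i < m"
    have zv: "(\<Sum>s<m. z s * to_ac (\<phi> v s)) = 0" if v: "v \<in> S" for v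
    proof -
      obtain l where l: "l < N" "v = col M l" using v Scols M by (auto simp: cols_def)
      have "(\<Sum>s<m. z s * to_ac (\<phi> v s)) = (\<Sum>s<m. z s * to_ac (M $$ (s, l)))"
        using l M by (intro sum.cong) (auto simp: \<phi>_def)
      then show ?thesis using z l(1) by simp
    qed
    have ze: "(\<Sum>s<m. z s * to_ac (e j s)) = z j" if "j < m" for j
      using that by (simp add: e_def if_distrib sum.delta cong: if_cong)
    have "z i = (\<Sum>s<m. z s * to_ac (e i s))" using ze[OF i] by simp
    also have "\<dots> = (\<Sum>s<m. (\<Sum>v\<in>S. to_ac (\<gamma> i (\<phi> v)) * (z s * to_ac (\<phi> v s)))
        + (\<Sum>j\<in>J. to_ac (\<gamma> i (e j)) * (z s * to_ac (e j s))))"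
      using \<gamma>[OF i] by (simp add: to_ac_sum distrib_left sum_distrib_left mult_ac)
    also have "\<dots> = (\<Sum>v\<in>S. to_ac (\<gamma> i (\<phi> v)) * (\<Sum>s<m. z s * to_ac (\<phi> v s)))
        + (\<Sum>j\<in>J. to_ac (\<gamma> i (e j)) * (\<Sum>s<m. z s * to_ac (e j s)))"
      unfolding sum.distrib sum_distrib_left by (intro arg_cong2[where f = "(+)"] sum.swap)
    also have "\<dots> = (\<Sum>j\<in>J. to_ac (\<gamma> i (e j)) * z j)"
      using zv ze by (simp add: J_def)
    finally show "z i = (\<Sum>j\<in>J. to_ac ((\<lambda>i j. \<gamma> i (e j)) i j) * z j)" by simp
  qed
qed

section \<open>Polytope faces off the origin\<close>

lemma lookup_scaleR [simp]: "Poly_Mapping.lookup (c *\<^sub>R w) j = c * Poly_Mapping.lookup w j"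
proof -
  have "finite {i. c * Poly_Mapping.lookup w i \<noteq> 0}"
    by (rule finite_subset[of _ "Poly_Mapping.keys w"]) (auto simp: in_keys_iff)
  then show ?thesis by (simp add: scaleR_poly_mapping_def)
qed

text \<open>
  Adding a generator enlarges the space of vectors that vanish on the chosen coordinates by at most one
  dimension, and one further coordinate, non-zero on a new such vector, removes it.  Choosing
  coordinates instead of a basis of the rows bounds the number of integral weights without any
  discussion of lattices.
\<close>

lemma ex_separating_coordinates:
  fixes S :: "('a \<Rightarrow>\<^sub>0 real) set"
  assumes "finite S"
  shows "\<exists>C. finite C \<and> card C \<le> card S \<and>
    (\<forall>w\<in>span S. (\<forall>j\<in>C. Poly_Mapping.lookup w j = 0) \<longrightarrow> w = 0)"
  using assms
proof induction
  case empty
  then show ?case by (intro exI[of _ "{}"]) auto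
next
  case (insert s S)
  then obtain C where C: "finite C" "card C \<le> card S"
    "\<And>w. w \<in> span S \<Longrightarrow> (\<And>j. j \<in> C \<Longrightarrow> Poly_Mapping.lookup w j = 0) \<Longrightarrow> w = 0"
    by blast
  show ?case
  proof (cases "\<forall>w\<in>span (insert s S). (\<forall>j\<in>C. Poly_Mapping.lookup w j = 0) \<longrightarrow> w = 0")
    case True
    then show ?thesis using C(1,2) insert.hyps by (intro exI[of _ C]) auto
  next
    case False
    then obtain w where w: "w \<in> span (insert s S)" "\<And>j. j \<in> C \<Longrightarrow> Poly_Mapping.lookup w j = 0" "w \<noteq> 0"
      by blast
    then obtain j0 where j0: "Poly_Mapping.lookup w j0 \<noteq> 0"
      by (metis lookup_zero poly_mapping_eqI)
    obtain b where b: "w - b *\<^sub>R s \<in> span S" using w(1) span_breakdown_eq by blast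
    \<comment> \<open>\<open>w\<close> really involves \<open>s\<close>, since on \<open>span S\<close> the coordinates in \<open>C\<close> suffice.\<close>
    have b0: "b \<noteq> 0" using C(3)[of w] b w by auto
    have "v = 0" if v: "v \<in> span (insert s S)" "\<forall>j\<in>insert j0 C. Poly_Mapping.lookup v j = 0" for v
    proof -
      obtain a where a: "v - a *\<^sub>R s \<in> span S" using v(1) span_breakdown_eq by blast
      have "(v - a *\<^sub>R s) - (a / b) *\<^sub>R (w - b *\<^sub>R s) \<in> span S"
        by (intro span_diff span_scale a b)
      then have "v - (a / b) *\<^sub>R w \<in> span S" using b0 by (simp add: scaleR_diff_right)
      then have eq: "v - (a / b) *\<^sub>R w = 0"
        by (rule C(3)) (use v(2) w(2) in \<open>simp add: lookup_minus\<close>)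
      then have "Poly_Mapping.lookup v j0 = (a / b) * Poly_Mapping.lookup w j0" by simp
      then have "a = 0" using v(2) j0 b0 by simp
      then show ?thesis using eq by simp
    qed
    then show ?thesis using C(1,2) insert.hyps
      by (intro exI[of _ "insert j0 C"]) (auto simp: card_insert_if)
  qed
qed

text \<open>
  A point of \<open>\<tau>\<close> together with a basis of the differences.  The ambient space is infinite-dimensional,
  and the finite set \<open>T\<close> is what makes that basis finite.
\<close>

lemma ex_spanning_of_affine_dimension:
  fixes \<tau> :: "'a::real_vector set"
  assumes "finite T" "\<tau> \<subseteq> span T" "\<tau> \<noteq> {}"
  shows "\<exists>S. finite S \<and> card S \<le> affine_dimension \<tau> + 1 \<and> \<tau> \<subseteq> span S"
proof -
  obtain x0 where x0: "x0 \<in> \<tau>" using assms(3) by auto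
  define V where "V = {x - y | x y. x \<in> \<tau> \<and> y \<in> \<tau>}"
  obtain B where B: "B \<subseteq> V" "independent B" "V \<subseteq> span B" "card B = dim V"
    using basis_exists by blast
  have "V \<subseteq> span T" using assms(2) by (auto simp: V_def intro!: span_diff)
  then have "finite B" using independent_span_bound[OF assms(1) B(2)] B(1) by auto
  have "x \<in> span (insert x0 B)" if "x \<in> \<tau>" for x
  proof -
    have "x - x0 \<in> span B" using B(3) that x0 by (auto simp: V_def)
    then have "x - x0 \<in> span (insert x0 B)" by (meson span_mono subset_iff subset_insertI)
    then show ?thesis using span_add[of "x - x0" "insert x0 B" x0] by (simp add: span_base)
  qed
  moreover have "card (insert x0 B) \<le> affine_dimension \<tau> + 1"
    using \<open>finite B\<close> B(4) by (simp add: affine_dimension_def V_def card_insert_if)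
  ultimately show ?thesis using \<open>finite B\<close> by (intro exI[of _ "insert x0 B"]) auto
qed

text \<open>
  Separate the relation by signs into \<open>a p = b q\<close> with \<open>p, q \<in> \<tau>\<close> and \<open>a > b \<ge> 0\<close>.  Then \<open>p\<close> lies
  between \<open>0\<close> and \<open>q\<close>, and a face containing \<open>p\<close> contains both ends of that segment.
\<close>

lemma sum_nonpos_of_relation_on_face:
  fixes r :: "'i \<Rightarrow> 'a::real_vector"
  assumes face: "\<tau> face_of \<Delta>" and "0 \<in> \<Delta>" "0 \<notin> \<tau>" "finite I" "\<And>i. i \<in> I \<Longrightarrow> r i \<in> \<tau>"
    and rel: "(\<Sum>i\<in>I. u i *\<^sub>R r i) = 0"
  shows "sum u I \<le> 0"
proof (rule ccontr)
  assume "\<not> ?thesis"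
  define I1 where "I1 = {i \<in> I. 0 < u i}"
  define I2 where "I2 = {i \<in> I. u i \<le> 0}"
  define a where "a = sum u I1"
  define b where "b = - sum u I2"
  have I: "I = I1 \<union> I2" "I1 \<inter> I2 = {}" "finite I1" "finite I2"
    using assms(4) by (auto simp: I1_def I2_def)
  have "sum u I = a - b" unfolding a_def b_def I(1) using I by (subst sum.union_disjoint) auto
  with \<open>\<not> ?thesis\<close> have ab: "a > b" by simp
  have b: "b \<ge> 0" unfolding b_def using sum_nonpos[of I2 u] by (simp add: I2_def)
  have conv: "convex \<tau>" using face by (rule face_of_imp_convex)
  define p where "p = (\<Sum>i\<in>I1. (u i / a) *\<^sub>R r i)"
  have p: "p \<in> \<tau>" unfolding p_def
    by (rule convex_sum[OF I(3) conv])
      (use ab b assms(5) in \<open>auto simp: I1_def a_def sum_divide_distrib[symmetric]\<close>)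
  have "(\<Sum>i\<in>I1. u i *\<^sub>R r i) + (\<Sum>i\<in>I2. u i *\<^sub>R r i) = 0"
    using rel I by (simp add: sum.union_disjoint)
  moreover have "(\<Sum>i\<in>I1. u i *\<^sub>R r i) = a *\<^sub>R p"
    using ab b by (simp add: p_def scaleR_right.sum)
  ultimately have ap: "a *\<^sub>R p = (\<Sum>i\<in>I2. (- u i) *\<^sub>R r i)"
    by (simp add: sum_negf add_eq_0_iff)
  show False
  proof (cases "b = 0")
    case True
    \<comment> \<open>There are no negative coefficients at all, so \<open>p\<close> itself is the origin.\<close>
    have "(\<Sum>i\<in>I2. - u i) = 0" using True by (simp add: b_def sum_negf)
    moreover have "\<And>i. i \<in> I2 \<Longrightarrow> 0 \<le> - u i" by (simp add: I2_def)
    ultimately have "\<forall>i\<in>I2. - u i = 0" using sum_nonneg_eq_0_iff[OF I(4), of "\<lambda>i. - u i"] by simp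
    then have "a *\<^sub>R p = 0" unfolding ap by simp
    then have "p = 0" using ab b by simp
    then show False using p assms(3) by simp
  next
    case False
    define q where "q = (\<Sum>i\<in>I2. (- u i / b) *\<^sub>R r i)"
    have q: "q \<in> \<tau>" unfolding q_def
      by (rule convex_sum[OF I(4) conv])
        (use b False assms(5) in \<open>auto simp: I2_def b_def sum_divide_distrib[symmetric] sum_negf divide_nonpos_nonpos\<close>)
    have "a *\<^sub>R p = b *\<^sub>R q" using False by (simp add: ap q_def scaleR_right.sum)
    then have "(1 / a) *\<^sub>R (a *\<^sub>R p) = (1 / a) *\<^sub>R (b *\<^sub>R q)" by simp
    then have p_eq: "p = (b / a) *\<^sub>R q" using ab b by simp
    have "0 \<noteq> q" using q assms(3) by auto
    then have "p \<in> open_segment 0 q"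
      using ab b False p_eq unfolding in_segment by (intro conjI exI[of _ "b / a"]) simp_all
    then have "0 \<in> \<tau>" using face_ofD[OF face] p q assms(2) face_of_imp_subset[OF face] by blast
    then show False using assms(3) by simp
  qed
qed

text \<open>
  Equivalently, \<open>0\<close> does not lie in the affine hull of the points: weights of monomials determine
  their degrees.
\<close>

lemma sum_zero_of_relation_on_face:
  fixes r :: "'i \<Rightarrow> 'a::real_vector"
  assumes "\<tau> face_of \<Delta>" and "0 \<in> \<Delta>" "0 \<notin> \<tau>" "finite I" "\<And>i. i \<in> I \<Longrightarrow> r i \<in> \<tau>"
    and rel: "(\<Sum>i\<in>I. u i *\<^sub>R r i) = 0"
  shows "sum u I = 0"
proof -
  have "(\<Sum>i\<in>I. (- u i) *\<^sub>R r i) = 0" using rel by (simp add: sum_negf)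
  from sum_nonpos_of_relation_on_face[OF assms(1-5) this] sum_nonpos_of_relation_on_face[OF assms]
  show ?thesis by (simp add: sum_negf)
qed

text \<open>
  For exponents of monomials in the coefficients at the rows of one face: few coordinates of the weight
  determine the whole weight and the degree.
\<close>

lemma rows_affinely_separated:
  fixes P :: "int mat" and m :: nat and p :: "nat \<Rightarrow> nat \<Rightarrow> int"
  assumes \<tau>: "\<tau> \<in> faces_off_origin (row_polytope P)"
    and \<rho>: "\<rho> ` {..<m} \<subseteq> rows_in P \<tau>"
    and p: "\<And>s j. p s j = (if j < dim_col P then P $$ (\<rho> s, j) else 0)"
  shows "\<exists>C. finite C \<and> card C \<le> affine_dimension \<tau> + 1 \<and>
    (\<forall>u. (\<forall>j\<in>C. (\<Sum>s<m. u s * p s j) = 0) \<longrightarrow>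
      (\<forall>j. (\<Sum>s<m. u s * p s j) = 0) \<and> (\<Sum>s<m. u s) = 0)"
proof -
  let ?\<Delta> = "row_polytope P" and ?T = "row_point P ` {..<dim_row P}"
  have face: "\<tau> face_of ?\<Delta>" and ne: "\<tau> \<noteq> {}" and off: "0 \<notin> \<tau>"
    using \<tau> by (auto simp: faces_off_origin_def)
  have "?\<Delta> \<subseteq> span ?T"
    using convex_hull_subset_span[of "insert 0 ?T"] by (simp add: row_polytope_def span_insert_0)
  then have "\<tau> \<subseteq> span ?T" using face_of_imp_subset[OF face] by blast
  then obtain S where S: "finite S" "card S \<le> affine_dimension \<tau> + 1" "\<tau> \<subseteq> span S"
    using ex_spanning_of_affine_dimension[of ?T \<tau>] ne by auto
  obtain C where C: "finite C" "card C \<le> card S"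
    "\<And>w. w \<in> span S \<Longrightarrow> (\<forall>j\<in>C. Poly_Mapping.lookup w j = 0) \<Longrightarrow> w = 0"
    using ex_separating_coordinates[OF S(1)] by blast
  have row: "row_point P (\<rho> s) \<in> \<tau>" "\<rho> s < dim_row P" if "s < m" for s
    using \<rho> that by (auto simp: rows_in_def)
  have lk: "Poly_Mapping.lookup (row_point P (\<rho> s)) j = real_of_int (p s j)" if "s < m" for s j
    using row(2)[OF that] by (auto simp: row_point_def p nth_default_def list_of_vec_index)
  have sep: "(\<forall>j. (\<Sum>s<m. u s * p s j) = 0) \<and> (\<Sum>s<m. u s) = 0"
    if u: "\<forall>j\<in>C. (\<Sum>s<m. u s * p s j) = 0" for u
  proof -
    define w where "w = (\<Sum>s<m. real_of_int (u s) *\<^sub>R row_point P (\<rho> s))"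
    have lw: "Poly_Mapping.lookup w j = real_of_int (\<Sum>s<m. u s * p s j)" for j
      by (simp add: w_def lookup_sum lk)
    have "w \<in> span S" unfolding w_def using row(1) S(3) by (intro span_sum span_scale) auto
    then have w0: "w = 0" by (rule C(3)) (use u in \<open>simp add: lw del: of_int_sum of_int_mult\<close>)
    have "0 \<in> ?\<Delta>" by (simp add: row_polytope_def hull_inc)
    from sum_zero_of_relation_on_face[OF face this off, where I = "{..<m}"
        and r = "\<lambda>s. row_point P (\<rho> s)" and u = "\<lambda>s. real_of_int (u s)"]
    have "(\<Sum>s<m. real_of_int (u s)) = 0" using w0 row(1) by (simp add: w_def)
    then have "(\<Sum>s<m. u s) = 0" by (simp flip: of_int_sum)
    moreover have "real_of_int (\<Sum>s<m. u s * p s j) = 0" for j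
      using lw[of j] w0 by simp
    then have "(\<Sum>s<m. u s * p s j) = 0" for j by (simp only: of_int_eq_0_iff)
    ultimately show ?thesis by blast
  qed
  have "card C \<le> affine_dimension \<tau> + 1" using C(2) S(2) by (rule order_trans)
  with C(1) sep show ?thesis by blast
qed

section \<open>Spectra of Laurent polynomial rings\<close>

lemma domain_laurent_ring: "domain (laurent_ring n :: 'a::idom laurent ring)"
proof -
  let ?R = "laurent_ring n :: 'a laurent ring"
  have "cring ?R"
  proof (intro cringI abelian_groupI comm_monoidI)
    fix f g :: "'a laurent"
    assume fg: "f \<in> carrier ?R" "g \<in> carrier ?R"
    show "f \<oplus>\<^bsub>?R\<^esub> g \<in> carrier ?R"
      using fg Poly_Mapping.keys_add[of f g] by (fastforce simp: laurent_ring_def)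
    show "f \<otimes>\<^bsub>?R\<^esub> g \<in> carrier ?R"
    proof -
      have "Poly_Mapping.keys m \<subseteq> {..<n}" if "m \<in> Poly_Mapping.keys (f * g)" for m
      proof -
        obtain a b where "m = a + b" "a \<in> Poly_Mapping.keys f" "b \<in> Poly_Mapping.keys g"
          using keys_mult[of f g] \<open>m \<in> _\<close> by blast
        moreover from this fg have "Poly_Mapping.keys a \<subseteq> {..<n}" "Poly_Mapping.keys b \<subseteq> {..<n}"
          by (auto simp: laurent_ring_def)
        ultimately show ?thesis using Poly_Mapping.keys_add[of a b] by blast
      qed
      then show ?thesis by (simp add: laurent_ring_def)
    qed
  next
    fix f :: "'a laurent" assume "f \<in> carrier ?R"
    then show "\<exists>g\<in>carrier ?R. g \<oplus>\<^bsub>?R\<^esub> f = \<zero>\<^bsub>?R\<^esub>"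
      by (intro bexI[of _ "- f"]) (auto simp: laurent_ring_def)
  qed (auto simp: laurent_ring_def algebra_simps)
  then show ?thesis
    by (intro domain.intro domain_axioms.intro) (auto simp: laurent_ring_def)
qed

lemma topspace_zariski_topology:
  "cring R \<Longrightarrow> topspace (zariski_topology R) = prime_spectrum R"
proof -
  assume "cring R"
  then interpret cring R .
  have "\<one>\<^bsub>R\<^esub> \<notin> I" if "primeideal I R" for I
    using that ideal.one_imp_carrier[of I R] by (auto simp: primeideal_def primeideal_axioms_def)
  then show ?thesis
    unfolding zariski_topology_def topology_generated_by_topspace
    by (auto simp: prime_spectrum_def intro!: exI[of _ "{I. primeideal I R \<and> \<one>\<^bsub>R\<^esub> \<notin> I}"] exI[of _ "\<one>\<^bsub>R\<^esub>"])
qed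

text \<open>
  The zero ideal is contained in every prime, so it avoids every function that some prime avoids.
\<close>

lemma generic_point_in_openin:
  assumes "domain R" "openin (zariski_topology R) W" "W \<noteq> {}"
  shows "{\<zero>\<^bsub>R\<^esub>} \<in> W"
proof -
  have prime: "primeideal {\<zero>\<^bsub>R\<^esub>} R" using assms(1) by (rule domain.zeroprimeideal)
  have "generate_topology_on {{I \<in> prime_spectrum R. f \<notin> I} | f. f \<in> carrier R} W"
    using assms(2) unfolding zariski_topology_def by (rule openin_topology_generated_by)
  then have "W \<noteq> {} \<longrightarrow> {\<zero>\<^bsub>R\<^esub>} \<in> W"
  proof induction
    case (Basis s)
    then obtain f where f: "s = {I \<in> prime_spectrum R. f \<notin> I}" by blast
    show ?case
    proof
      assume "s \<noteq> {}"
      then obtain I where "primeideal I R" "f \<notin> I" by (auto simp: f prime_spectrum_def)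
      then have "f \<noteq> \<zero>\<^bsub>R\<^esub>"
        using additive_subgroup.zero_closed[of I R] by (auto simp: primeideal_def ideal_def)
      then show "{\<zero>\<^bsub>R\<^esub>} \<in> s" using prime by (simp add: f prime_spectrum_def)
    qed
  qed auto
  with assms(3) show ?thesis by blast
qed

lemma dense_openin_zariski:
  assumes "domain R" "openin (zariski_topology R) W" "W \<noteq> {}"
  shows "dense_openin (zariski_topology R) W"
  using generic_point_in_openin[OF assms] generic_point_in_openin[OF assms(1)] assms(2)
  unfolding dense_openin_def closure_of_def by blast

lemma openin_finite_nonvanishing:
  assumes "cring R" "finite H" "H \<subseteq> carrier R"
  shows "openin (zariski_topology R) {I \<in> prime_spectrum R. \<forall>h\<in>H. h \<notin> I}"
  using assms(2,3)
proof induction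
  case empty
  then show ?case using openin_topspace[of "zariski_topology R"] topspace_zariski_topology[OF assms(1)]
    by simp
next
  case (insert h H)
  have "openin (zariski_topology R) {I \<in> prime_spectrum R. h \<notin> I}"
    unfolding zariski_topology_def
    by (rule topology_generated_by_Basis) (use insert.prems in auto)
  with insert have "openin (zariski_topology R)
      ({I \<in> prime_spectrum R. h \<notin> I} \<inter> {I \<in> prime_spectrum R. \<forall>h\<in>H. h \<notin> I})"
    by (intro openin_Int) auto
  then show ?case by (rule back_subst[of "openin _"]) auto
qed

section \<open>Homomorphisms of tori\<close>

lemma lookup_exponent_of_vec:
  "Poly_Mapping.lookup (exponent_of_vec v) j = (if j < dim_vec v then v $ j else 0)"
  by (auto simp: exponent_of_vec_def nth_default_def list_of_vec_index)

definition pullback_exponent :: "int mat \<Rightarrow> (nat \<Rightarrow>\<^sub>0 int) \<Rightarrow> (nat \<Rightarrow>\<^sub>0 int)" where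
  "pullback_exponent M m =
     exponent_of_vec (transpose_mat M *\<^sub>v vec (dim_row M) (Poly_Mapping.lookup m))"

lemma lookup_pullback_exponent:
  "Poly_Mapping.lookup (pullback_exponent M m) j =
     (if j < dim_col M then \<Sum>i<dim_row M. Poly_Mapping.lookup m i * M $$ (i, j) else 0)"
  by (auto simp: pullback_exponent_def lookup_exponent_of_vec scalar_prod_def atLeast0LessThan
      mult.commute intro!: sum.cong)

lemma pullback_exponent_add: "pullback_exponent M (m + m') = pullback_exponent M m + pullback_exponent M m'"
  by (rule poly_mapping_eqI) (simp add: lookup_pullback_exponent lookup_add distrib_right sum.distrib)

lemma pullback_exponent_zero: "pullback_exponent M 0 = 0"
  by (rule poly_mapping_eqI) (simp add: lookup_pullback_exponent)

lemma torus_comorphism_single: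
  "torus_comorphism M (Poly_Mapping.single m c) = Poly_Mapping.single (pullback_exponent M m) c"
  by (cases "c = 0") (simp_all add: torus_comorphism_def pullback_exponent_def)

lemma torus_comorphism_add:
  "torus_comorphism M (f + g) = torus_comorphism M f + torus_comorphism M g"
  unfolding torus_comorphism_def by (rule setsum_keys_plus_distrib) (simp_all add: single_add)

lemma torus_comorphism_zero: "torus_comorphism M 0 = 0"
  by (simp add: torus_comorphism_def)

lemma torus_comorphism_sum: "torus_comorphism M (\<Sum>i\<in>A. f i) = (\<Sum>i\<in>A. torus_comorphism M (f i))"
  by (induction A rule: infinite_finite_induct)
    (simp_all add: torus_comorphism_add torus_comorphism_zero)

lemma sum_single_lookup: "(\<Sum>m\<in>Poly_Mapping.keys f. Poly_Mapping.single m (Poly_Mapping.lookup f m)) = f"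
  by (rule poly_mapping_eqI) (auto simp: lookup_sum lookup_single when_def in_keys_iff)

text \<open>
  The comorphism acts additively on exponents, so it suffices to expand both factors into monomials.
\<close>

lemma torus_comorphism_mult:
  "torus_comorphism M (f * g) = torus_comorphism M f * torus_comorphism M g"
proof -
  have "torus_comorphism M ((\<Sum>m\<in>A. Poly_Mapping.single m (c m)) * (\<Sum>m\<in>B. Poly_Mapping.single m (d m)))
     = torus_comorphism M (\<Sum>m\<in>A. Poly_Mapping.single m (c m)) *
       torus_comorphism M (\<Sum>m\<in>B. Poly_Mapping.single m (d m))" for A B and c d :: "_ \<Rightarrow> 'a"
    by (simp add: sum_product mult_single torus_comorphism_sum torus_comorphism_single
        pullback_exponent_add)
  from this[where A = "Poly_Mapping.keys f" and c = "Poly_Mapping.lookup f"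
      and B = "Poly_Mapping.keys g" and d = "Poly_Mapping.lookup g"]
  show ?thesis by (simp add: sum_single_lookup)
qed

lemma torus_comorphism_closed:
  "torus_comorphism M f \<in> carrier (laurent_ring (dim_col M))"
proof -
  have "Poly_Mapping.keys (pullback_exponent M m) \<subseteq> {..<dim_col M}" for m
    by (auto simp: in_keys_iff lookup_pullback_exponent split: if_splits)
  then show ?thesis
    using Poly_Mapping.keys_sum[of "\<lambda>m. Poly_Mapping.single (pullback_exponent M m) (Poly_Mapping.lookup f m)" "Poly_Mapping.keys f"]
    by (fastforce simp: laurent_ring_def torus_comorphism_def pullback_exponent_def split: if_splits)
qed

lemma torus_hom_in_spectrum:
  fixes I :: "'a::idom laurent set"
  assumes "I \<in> prime_spectrum (laurent_ring (dim_col M))"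
  shows "torus_hom M I \<in> prime_spectrum (laurent_ring (dim_row M))"
proof -
  let ?R = "laurent_ring (dim_row M) :: 'a laurent ring" and ?S = "laurent_ring (dim_col M) :: 'a laurent ring"
  have R: "cring ?R" and S: "cring ?S" using domain_laurent_ring by (auto simp: domain_def)
  have "ring_hom_ring ?R ?S (torus_comorphism M)"
  proof (rule ring_hom_ringI)
    show "ring ?R" "ring ?S" using R S by (auto simp: cring_def)
    show "torus_comorphism M \<one>\<^bsub>?R\<^esub> = \<one>\<^bsub>?S\<^esub>"
      using torus_comorphism_single[of M 0 "1::'a"] by (simp add: laurent_ring_def pullback_exponent_zero)
    show "torus_comorphism M f \<in> carrier ?S" for f by (rule torus_comorphism_closed)
  qed (simp_all add: laurent_ring_def torus_comorphism_mult torus_comorphism_add)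
  from ring_hom_ring.primeideal_vimage[OF this R, of I] assms show ?thesis
    by (simp add: prime_spectrum_def torus_hom_def)
qed

text \<open>
  No two monomials of \<open>h\<close> are mapped to the same one, so nothing cancels.
\<close>

lemma torus_comorphism_nonzero:
  assumes "inj_on (pullback_exponent M) (Poly_Mapping.keys h)" "h \<noteq> 0"
  shows "torus_comorphism M h \<noteq> 0"
proof -
  obtain e where e: "e \<in> Poly_Mapping.keys h" using assms(2) by fastforce
  have "torus_comorphism M h =
      (\<Sum>m\<in>Poly_Mapping.keys h. Poly_Mapping.single (pullback_exponent M m) (Poly_Mapping.lookup h m))"
    by (simp add: torus_comorphism_def pullback_exponent_def)
  then have "Poly_Mapping.lookup (torus_comorphism M h) (pullback_exponent M e) =
      (\<Sum>m\<in>Poly_Mapping.keys h. Poly_Mapping.lookup h m when m = e)"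
    using assms(1) e by (auto simp: lookup_sum lookup_single inj_on_eq_iff intro!: sum.cong)
  also have "\<dots> = Poly_Mapping.lookup h e" using e by (simp add: when_def)
  finally show ?thesis using e by (auto simp: in_keys_iff)
qed

text \<open>
  If all exponents in \<open>E\<close> have the same image under the last columns, two with the same image
  under the first columns have the same image under \<open>P\<^sup>T\<close>, which is injective.
\<close>

lemma inj_on_pullback_exponent_first_cols:
  fixes P :: "int mat"
  assumes P: "P \<in> carrier_mat n n" and inv: "invertible_mat P" and k: "k \<le> n"
    and supp: "\<And>e. e \<in> E \<Longrightarrow> Poly_Mapping.keys e \<subseteq> {..<n}"
    and iso: "\<And>e e'. e \<in> E \<Longrightarrow> e' \<in> E \<Longrightarrow>
      pullback_exponent (drop_cols k P) e = pullback_exponent (drop_cols k P) e'"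
  shows "inj_on (pullback_exponent (first_cols k P)) E"
proof (rule inj_onI)
  fix e e' assume e: "e \<in> E" "e' \<in> E"
    and eq: "pullback_exponent (first_cols k P) e = pullback_exponent (first_cols k P) e'"
  obtain R where R: "P * R = 1\<^sub>m n" "R \<in> carrier_mat n n"
  proof -
    obtain R where "inverts_mat P R" "inverts_mat R P" using inv by (auto simp: invertible_mat_def)
    then have "P * R = 1\<^sub>m n" "R * P = 1\<^sub>m (dim_row R)" using P by (auto simp: inverts_mat_def)
    moreover from this have "dim_row R = n" "dim_col R = n"
      using P by (metis carrier_matD(2) index_mult_mat(3) index_one_mat(3))+
    ultimately show ?thesis using that by blast
  qed
  have dims: "dim_row P = n" "dim_col P = n" using P by auto
  have same: "(\<Sum>i<n. Poly_Mapping.lookup e i * P $$ (i, j)) = (\<Sum>i<n. Poly_Mapping.lookup e' i * P $$ (i, j))"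
    if j: "j < n" for j
  proof (cases "j < k")
    case True
    then show ?thesis
      using arg_cong[OF eq, of "\<lambda>m. Poly_Mapping.lookup m j"] k
      by (simp add: lookup_pullback_exponent first_cols_def dims)
  next
    case False
    then have "j - k < n - k" "k + (j - k) = j" using j by auto
    then show ?thesis
      using arg_cong[OF iso[OF e], of "\<lambda>m. Poly_Mapping.lookup m (j - k)"]
      by (simp add: lookup_pullback_exponent drop_cols_def dims)
  qed
  have rec: "Poly_Mapping.lookup u l = (\<Sum>j<n. (\<Sum>i<n. Poly_Mapping.lookup u i * P $$ (i, j)) * R $$ (j, l))"
    if l: "l < n" for u l
  proof -
    have PR: "(\<Sum>j<n. P $$ (i, j) * R $$ (j, l)) = (if i = l then 1 else 0)" if i: "i < n" for i
    proof -
      have "(P * R) $$ (i, l) = (\<Sum>j<n. P $$ (i, j) * R $$ (j, l))"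
        using P R(2) i l by (auto simp: scalar_prod_def atLeast0LessThan intro!: sum.cong)
      then show ?thesis using R(1) i l by simp
    qed
    have "(\<Sum>j<n. (\<Sum>i<n. Poly_Mapping.lookup u i * P $$ (i, j)) * R $$ (j, l)) =
        (\<Sum>i<n. Poly_Mapping.lookup u i * (\<Sum>j<n. P $$ (i, j) * R $$ (j, l)))"
      unfolding sum_distrib_left sum_distrib_right by (subst sum.swap) (simp add: mult.assoc)
    also have "\<dots> = (\<Sum>i<n. if i = l then Poly_Mapping.lookup u i else 0)"
      by (intro sum.cong) (simp_all add: PR)
    also have "\<dots> = Poly_Mapping.lookup u l" using l by simp
    finally show ?thesis by simp
  qed
  show "e = e'"
  proof (rule poly_mapping_eqI)
    fix l show "Poly_Mapping.lookup e l = Poly_Mapping.lookup e' l"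
    proof (cases "l < n")
      case True
      show ?thesis unfolding rec[OF True] by (intro sum.cong) (simp_all add: same)
    next
      case False
      then have "l \<notin> Poly_Mapping.keys e" "l \<notin> Poly_Mapping.keys e'" using supp e by auto
      then show ?thesis by (simp add: in_keys_iff)
    qed
  qed
qed

section \<open>Values and derivatives of Laurent polynomials\<close>

lemma laurent_eval_single:
  "laurent_eval x (Poly_Mapping.single m c) = c * (\<Prod>j<dim_vec x. x $ j powi Poly_Mapping.lookup m j)"
  by (cases "c = 0") (simp_all add: laurent_eval_def)

lemma laurent_eval_sum: "laurent_eval x (\<Sum>i\<in>A. f i) = (\<Sum>i\<in>A. laurent_eval x (f i))"
proof -
  have "laurent_eval x (f + g) = laurent_eval x f + laurent_eval x g" for f g
    unfolding laurent_eval_def by (rule setsum_keys_plus_distrib) (simp_all add: distrib_right)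
  moreover have "laurent_eval x 0 = 0" by (simp add: laurent_eval_def)
  ultimately show ?thesis by (induction A rule: infinite_finite_induct) simp_all
qed

lemma laurent_deriv_single:
  "laurent_deriv j (Poly_Mapping.single m c) =
     Poly_Mapping.single (m - Poly_Mapping.single j 1) (of_int (Poly_Mapping.lookup m j) * c)"
  by (cases "c = 0") (simp_all add: laurent_deriv_def)

lemma laurent_deriv_sum: "laurent_deriv j (\<Sum>i\<in>A. f i) = (\<Sum>i\<in>A. laurent_deriv j (f i))"
proof -
  have "laurent_deriv j (f + g) = laurent_deriv j f + laurent_deriv j g" for f g :: "'a::comm_ring_1 laurent"
    unfolding laurent_deriv_def by (rule setsum_keys_plus_distrib) (simp_all add: distrib_left single_add)
  moreover have "laurent_deriv j 0 = 0" by (simp add: laurent_deriv_def)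
  ultimately show ?thesis by (induction A rule: infinite_finite_induct) simp_all
qed

lemma lookup_map_to_ac [simp]:
  "Poly_Mapping.lookup (Poly_Mapping.map to_ac f) m = to_ac (Poly_Mapping.lookup f m)"
  by (simp add: Poly_Mapping.map.rep_eq when_def split: if_splits)

lemma map_to_ac_sum_single:
  "Poly_Mapping.map to_ac (\<Sum>t\<in>F. Poly_Mapping.single (e t) (c t)) =
     (\<Sum>t\<in>F. Poly_Mapping.single (e t) (to_ac (c t)))"
  by (rule poly_mapping_eqI) (auto simp: lookup_sum lookup_single to_ac_sum when_def intro!: sum.cong)

lemma power_int_sum:
  fixes x :: "'a::field"
  assumes "x \<noteq> 0"
  shows "x powi (\<Sum>i\<in>A. f i) = (\<Prod>i\<in>A. x powi f i)"
  using assms by (induction A rule: infinite_finite_induct) (simp_all add: power_int_add)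

text \<open>
  The critical point equations say that \<open>(a\<^sub>i x\<^bsup>r\<^sub>i\<^esup>)\<close> lies in the left kernel of the face matrix.
  Multiplying by \<open>x\<^sub>l\<close> turns the ordinary derivative into the logarithmic one.
\<close>

lemma eval_deriv_face_laurent:
  fixes a x :: "'a::field Matrix.vec"
  assumes x: "x \<in> torus_points (dim_col P)" and l: "l < dim_col P"
  shows "x $ l * laurent_eval x (laurent_deriv l (face_laurent P a \<tau>)) =
    (\<Sum>i\<in>rows_in P \<tau>. of_int (P $$ (i, l)) * (a $ i * (\<Prod>j<dim_col P. x $ j powi P $$ (i, j))))"
proof -
  have dx: "dim_vec x = dim_col P" and x0: "\<And>j. j < dim_col P \<Longrightarrow> x $ j \<noteq> 0"
    using x by (auto simp: torus_points_def)
  have "x $ l * (\<Prod>j<dim_col P. x $ j powi (P $$ (i, j) - (if j = l then 1 else 0))) =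
     (\<Prod>j<dim_col P. x $ j powi P $$ (i, j))" for i
  proof -
    have "(\<Prod>j\<in>{..<dim_col P} - {l}. x $ j powi (P $$ (i, j) - (if j = l then 1 else 0))) =
      (\<Prod>j\<in>{..<dim_col P} - {l}. x $ j powi P $$ (i, j))"
      by (rule prod.cong) auto
    moreover have "x $ l * x $ l powi (P $$ (i, l) - 1) = x $ l powi P $$ (i, l)"
      using x0[OF l] by (simp add: power_int_diff)
    ultimately show ?thesis
      using l by (simp add: prod.remove[of "{..<dim_col P}" l] mult.assoc[symmetric])
  qed note shift = this
  have lk: "Poly_Mapping.lookup (exponent_of_vec (row P i)) j = P $$ (i, j)"
    if "i \<in> rows_in P \<tau>" "j < dim_col P" for i j
    using that by (simp add: lookup_exponent_of_vec rows_in_def)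
  have "x $ l * laurent_eval x (laurent_deriv l (face_laurent P a \<tau>)) =
    (\<Sum>i\<in>rows_in P \<tau>. of_int (P $$ (i, l)) * (a $ i * (x $ l *
       (\<Prod>j<dim_col P. x $ j powi (P $$ (i, j) - (if j = l then 1 else 0))))))"
    unfolding face_laurent_def laurent_deriv_sum laurent_eval_sum sum_distrib_left
  proof (intro sum.cong refl)
    fix i assume i: "i \<in> rows_in P \<tau>"
    have "(\<Prod>j<dim_col P. x $ j powi (Poly_Mapping.lookup (exponent_of_vec (row P i) - Poly_Mapping.single l 1) j)) =
        (\<Prod>j<dim_col P. x $ j powi (P $$ (i, j) - (if j = l then 1 else 0)))"
      using lk[OF i] by (intro prod.cong) (auto simp: lookup_minus lookup_single when_def)
    then show "x $ l * laurent_eval x (laurent_deriv l (Poly_Mapping.single (exponent_of_vec (row P i)) (a $ i))) =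
        of_int (P $$ (i, l)) * (a $ i * (x $ l *
          (\<Prod>j<dim_col P. x $ j powi (P $$ (i, j) - (if j = l then 1 else 0)))))"
      by (simp add: laurent_deriv_single laurent_eval_single dx lk[OF i l] mult_ac)
  qed
  then show ?thesis unfolding shift .
qed

section \<open>Isobaric equations for degenerate coefficients\<close>

text \<open>
  Many monomials of one weight, restricted to a space with few parameters: the fibre of
  \<open>ex_large_fibre\<close> has more elements than there are monomials of the common degree in the variables
  \<open>z\<^sub>j\<close>, \<open>j \<in> J\<close>.
\<close>

lemma ex_isobaric_relation:
  fixes p :: "nat \<Rightarrow> nat \<Rightarrow> int" and \<beta> :: "nat \<Rightarrow> nat \<Rightarrow> 'q::field"
  assumes C: "finite C" and J: "finite J" "J \<noteq> {}" and card: "card C + card J \<le> m"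
    and sep: "\<And>u. (\<And>j. j \<in> C \<Longrightarrow> (\<Sum>s<m. u s * p s j) = 0) \<Longrightarrow>
      (\<forall>j. (\<Sum>s<m. u s * p s j) = 0) \<and> (\<Sum>s<m. u s) = 0"
  shows "\<exists>F c. finite F \<and> F \<subseteq> {..<m} \<rightarrow>\<^sub>E UNIV \<and> (\<exists>t\<in>F. c t \<noteq> 0) \<and>
    (\<forall>t\<in>F. \<forall>t'\<in>F. \<forall>j. (\<Sum>s<m. int (t s) * p s j) = (\<Sum>s<m. int (t' s) * p s j)) \<and>
    (\<forall>z. (\<Sum>t\<in>F. to_ac (c t) * (\<Prod>s<m. (\<Sum>j\<in>J. to_ac (\<beta> s j) * z j) ^ t s)) = 0)"
proof -
  have "0 < card J" using J by (simp add: card_gt_0_iff)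
  then obtain B F w where F: "F \<subseteq> {..<m} \<rightarrow>\<^sub>E {..B::nat}" "(B * m + 1) ^ (card J - 1) < card F"
    "\<And>t j. t \<in> F \<Longrightarrow> j \<in> C \<Longrightarrow> (\<Sum>s<m. int (t s) * p s j) = w j"
    using ex_large_fibre[of "{..<m}" C "card J" p] C card by auto
  have fF: "finite F" using F(1) by (rule finite_subset) (intro finite_PiE; simp)
  have same: "(\<forall>j. (\<Sum>s<m. int (t s) * p s j) = (\<Sum>s<m. int (t' s) * p s j)) \<and>
      (\<Sum>s<m. t s) = (\<Sum>s<m. t' s)" if t: "t \<in> F" "t' \<in> F" for t t'
  proof -
    have "(\<forall>j. (\<Sum>s<m. (int (t s) - int (t' s)) * p s j) = 0) \<and> (\<Sum>s<m. int (t s) - int (t' s)) = 0"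
      by (rule sep) (simp add: left_diff_distrib sum_subtractf F(3)[OF t(1)] F(3)[OF t(2)])
    then show ?thesis
      by (simp add: left_diff_distrib sum_subtractf of_nat_eq_iff flip: of_nat_sum)
  qed
  obtain t0 where t0: "t0 \<in> F" using F(2) by fastforce
  define g where "g = (\<Sum>s<m. t0 s)"
  have "g \<le> (\<Sum>s<m. B)" unfolding g_def using t0 F(1) by (intro sum_mono) auto
  then have g: "g \<le> B * m" by (simp add: mult.commute)
  define G where "G = (monomials J g :: ((nat \<Rightarrow> 'q alg_closure) \<Rightarrow> _) set)"
  have "card G \<le> (g + 1) ^ (card J - 1)" unfolding G_def by (rule monomials_bound[OF J])
  also have "\<dots> \<le> (B * m + 1) ^ (card J - 1)" using g by (intro power_mono) auto
  also have "\<dots> < card F" by (rule F(2))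
  finally have cG: "card G < card F" .
  define f where "f t = (\<lambda>z. \<Prod>s<m. (\<Sum>j\<in>J. to_ac (\<beta> s j) * z j) ^ t s)" for t
  have "f t \<in> ac_fun.span G" if "t \<in> F" for t
  proof -
    have "(\<Sum>s<m. t s) = g" using same[OF that t0] by (simp add: g_def)
    then show ?thesis
      using prod_linear_in_span_monomials[OF J(1) finite_lessThan, of \<beta> t m] by (simp add: f_def G_def)
  qed
  then have "f ` F \<subseteq> ac_fun.span G" by blast
  moreover have "finite G" unfolding G_def by (rule monomials_bound[OF J])
  ultimately have "\<exists>c. (\<exists>t\<in>F. c t \<noteq> 0) \<and> (\<Sum>t\<in>F. ac_scale (c t) (f t)) = 0"
    using ac_fun.dependent_family[OF fF _ cG, of f] by simp
  then obtain c where c: "\<exists>t\<in>F. c t \<noteq> 0" "(\<Sum>t\<in>F. ac_scale (c t) (f t)) = 0"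
    by blast
  show ?thesis
  proof (intro exI conjI ballI allI)
    show "finite F" by (rule fF)
    show "F \<subseteq> {..<m} \<rightarrow>\<^sub>E UNIV" using F(1) by (auto simp: PiE_iff)
    show "\<exists>t\<in>F. c t \<noteq> 0" by (rule c(1))
    show "(\<Sum>s<m. int (t s) * p s j) = (\<Sum>s<m. int (t' s) * p s j)" if "t \<in> F" "t' \<in> F" for t t' j
      using same[OF that] by blast
    show "(\<Sum>t\<in>F. to_ac (c t) * (\<Prod>s<m. (\<Sum>j\<in>J. to_ac (\<beta> s j) * z j) ^ t s)) = 0" for z
      using fun_cong[OF c(2), of z] by (simp add: sum_fun_apply f_def)
  qed
qed

lemma bij_betw_pick:
  assumes "finite I"
  shows "bij_betw (pick I) {..<card I} I"
proof -
  have inj: "inj_on (pick I) {..<card I}"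
  proof (rule inj_onI)
    fix a b assume "a \<in> {..<card I}" "b \<in> {..<card I}" and eq: "pick I a = pick I b"
    then have "\<not> a < b" "\<not> b < a" using pick_mono_le[of b I a] pick_mono_le[of a I b] by auto
    then show "a = b" by simp
  qed
  have "pick I ` {..<card I} = I"
  proof (rule card_subset_eq[OF assms])
    show "pick I ` {..<card I} \<subseteq> I" using pick_in_set_le by auto
    show "card (pick I ` {..<card I}) = card I" by (simp add: card_image[OF inj])
  qed
  with inj show ?thesis by (simp add: bij_betw_def)
qed

text \<open>
  An equation, defined over the base field, of the coefficients that are degenerate at \<open>\<tau>\<close>.  All
  its exponents having one weight serves twice: it eliminates the critical point \<open>x\<close> from the
  relation of \<open>ex_isobaric_relation\<close>, and later it prevents cancellation under \<open>[P\<^sub>1]\<close>.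
\<close>

lemma ex_isobaric_equation:
  fixes P :: "int mat"
  assumes P: "P \<in> carrier_mat n N"
    and \<tau>: "\<tau> \<in> faces_off_origin (row_polytope P)"
    and rank: "mat_rank (map_mat (of_int :: int \<Rightarrow> 'q::field) (submatrix P (rows_in P \<tau>) UNIV))
      = affine_dimension \<tau> + 1"
  shows "\<exists>h :: 'q laurent. h \<in> carrier (laurent_ring n) \<and> h \<noteq> 0 \<and>
    (\<forall>e\<in>Poly_Mapping.keys h. \<forall>e'\<in>Poly_Mapping.keys h. pullback_exponent P e = pullback_exponent P e') \<and>
    (\<forall>a\<in>torus_points n. laurent_eval a (Poly_Mapping.map to_ac h) \<noteq> 0 \<longrightarrow>
      \<not> (\<exists>x\<in>torus_points N. \<forall>j<N. laurent_eval x (laurent_deriv j (face_laurent P a \<tau>)) = 0))"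
proof -
  define I where "I = rows_in P \<tau>"
  define m where "m = card I"
  define \<rho> where "\<rho> = pick I"
  define p where "p s j = (if j < dim_col P then P $$ (\<rho> s, j) else 0)" for s j
  define M where "M = map_mat (of_int :: int \<Rightarrow> 'q) (submatrix P I UNIV)"
  have dims: "dim_row P = n" "dim_col P = N" using P by auto
  have p: "p s j = (if j < N then P $$ (\<rho> s, j) else 0)" for s j by (simp add: p_def dims)
  have I: "finite I" "I \<subseteq> {..<n}" by (auto simp: I_def rows_in_def dims)
  have \<rho>: "bij_betw \<rho> {..<m} I" unfolding \<rho>_def m_def by (rule bij_betw_pick[OF I(1)])
  have \<rho>n: "\<rho> s < n" if "s < m" for s using bij_betwE[OF \<rho>] I(2) that by auto
  have \<rho>I: "\<rho> ` {..<m} \<subseteq> rows_in P \<tau>" using \<rho> by (simp add: bij_betw_def I_def)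
  have \<rho>inj: "inj_on \<rho> {..<m}" using \<rho> by (rule bij_betw_imp_inj_on)
  have rowset: "{i. i < n \<and> i \<in> I} = I" using I(2) by auto
  have M: "M \<in> carrier_mat m N"
    unfolding M_def m_def by (intro carrier_matI) (simp_all add: dim_submatrix dims rowset)
  have Mij: "M $$ (s, l) = of_int (P $$ (\<rho> s, l))" if "s < m" "l < N" for s l
    using that unfolding M_def m_def \<rho>_def
    by (simp add: dim_submatrix dims rowset submatrix_index pick_UNIV)
  from rows_affinely_separated[OF \<tau> \<rho>I p_def]
  obtain C where C: "finite C" "card C \<le> affine_dimension \<tau> + 1"
    and sep: "\<forall>u. (\<forall>j\<in>C. (\<Sum>s<m. u s * p s j) = 0) \<longrightarrow>
      (\<forall>j. (\<Sum>s<m. u s * p s j) = 0) \<and> (\<Sum>s<m. u s) = 0"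
    by (elim exE conjE)
  from left_kernel_parametrization[OF M]
  obtain J \<beta> where J: "J \<subseteq> {..<m}" "card J + mat_rank M \<le> m"
    and \<beta>: "\<forall>z. (\<forall>l<N. (\<Sum>s<m. z s * to_ac (M $$ (s, l))) = 0) \<longrightarrow>
        (\<forall>i<m. z i = (\<Sum>j\<in>J. to_ac (\<beta> i j) * z j))"
    by (elim exE conjE)
  have rankM: "mat_rank M = affine_dimension \<tau> + 1" using rank by (simp add: M_def I_def)
  have fJ: "finite J" using J(1) finite_subset by blast
  define \<xi> where "\<xi> x s = (\<Prod>j<N. x $ j powi p s j)" for x :: "'q alg_closure Matrix.vec" and s
  have critical: "\<forall>i<m. a $ \<rho> i * \<xi> x i = (\<Sum>j\<in>J. to_ac (\<beta> i j) * (a $ \<rho> j * \<xi> x j))"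
    if x: "x \<in> torus_points N"
      and crit: "\<forall>j<N. laurent_eval x (laurent_deriv j (face_laurent P a \<tau>)) = 0"
    for a x :: "'q alg_closure Matrix.vec"
  proof (rule \<beta>[THEN spec, THEN mp], intro allI impI)
    fix l assume l: "l < N"
    have "(\<Sum>s<m. a $ \<rho> s * \<xi> x s * to_ac (M $$ (s, l))) =
        (\<Sum>s<m. of_int (P $$ (\<rho> s, l)) * (a $ \<rho> s * (\<Prod>j<N. x $ j powi P $$ (\<rho> s, j))))"
      using l by (intro sum.cong) (auto simp: \<xi>_def p Mij mult_ac)
    also have "\<dots> = (\<Sum>i\<in>I. of_int (P $$ (i, l)) * (a $ i * (\<Prod>j<N. x $ j powi P $$ (i, j))))"
      by (rule sum.reindex_bij_betw[OF \<rho>])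
    also have "\<dots> = x $ l * laurent_eval x (laurent_deriv l (face_laurent P a \<tau>))"
      using eval_deriv_face_laurent[of x P l a \<tau>] x l by (simp add: dims I_def)
    finally show "(\<Sum>s<m. a $ \<rho> s * \<xi> x s * to_ac (M $$ (s, l))) = 0" using crit l by simp
  qed
  have \<xi>0: "\<xi> x s \<noteq> 0" if "x \<in> torus_points N" for x s
    using that by (auto simp: \<xi>_def torus_points_def)
  show ?thesis
  proof (cases "J = {}")
    case True
    \<comment> \<open>The left kernel is zero, but the vector of a critical point has only non-zero entries.\<close>
    have "0 < m" using J(2) rankM by simp
    have "\<not> (\<exists>x\<in>torus_points N. \<forall>j<N. laurent_eval x (laurent_deriv j (face_laurent P a \<tau>)) = 0)"
      if a: "a \<in> torus_points n" for a :: "'q alg_closure Matrix.vec"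
    proof
      assume "\<exists>x\<in>torus_points N. \<forall>j<N. laurent_eval x (laurent_deriv j (face_laurent P a \<tau>)) = 0"
      then obtain x where x: "x \<in> torus_points N"
        "\<forall>j<N. laurent_eval x (laurent_deriv j (face_laurent P a \<tau>)) = 0" by blast
      have "a $ \<rho> 0 * \<xi> x 0 = 0" using critical[OF x] \<open>0 < m\<close> True by simp
      then show False using \<xi>0[OF x(1)] a \<rho>n[OF \<open>0 < m\<close>] by (simp add: torus_points_def)
    qed
    then show ?thesis by (intro exI[of _ 1]) (simp add: laurent_ring_def)
  next
    case False
    have "card C + card J \<le> m" using C(2) J(2) rankM by simp
    have "\<exists>F (c :: (nat \<Rightarrow> nat) \<Rightarrow> 'q). finite F \<and> F \<subseteq> {..<m} \<rightarrow>\<^sub>E UNIV \<and> (\<exists>t\<in>F. c t \<noteq> 0) \<and>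
      (\<forall>t\<in>F. \<forall>t'\<in>F. \<forall>j. (\<Sum>s<m. int (t s) * p s j) = (\<Sum>s<m. int (t' s) * p s j)) \<and>
      (\<forall>z. (\<Sum>t\<in>F. to_ac (c t) * (\<Prod>s<m. (\<Sum>j\<in>J. to_ac (\<beta> s j) * z j) ^ t s)) = 0)"
    proof (rule ex_isobaric_relation[OF C(1) fJ False \<open>card C + card J \<le> m\<close>])
      show "(\<forall>j. (\<Sum>s<m. u s * p s j) = 0) \<and> (\<Sum>s<m. u s) = 0"
        if "\<And>j. j \<in> C \<Longrightarrow> (\<Sum>s<m. u s * p s j) = 0" for u
        by (rule sep[THEN spec, THEN mp]) (intro ballI that)
    qed
    then obtain F and c :: "(nat \<Rightarrow> nat) \<Rightarrow> 'q" where F: "finite F" "F \<subseteq> {..<m} \<rightarrow>\<^sub>E UNIV" "\<exists>t\<in>F. c t \<noteq> 0"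
      and iso: "\<forall>t\<in>F. \<forall>t'\<in>F. \<forall>j. (\<Sum>s<m. int (t s) * p s j) = (\<Sum>s<m. int (t' s) * p s j)"
      and rel: "\<forall>z. (\<Sum>t\<in>F. to_ac (c t) * (\<Prod>s<m. (\<Sum>j\<in>J. to_ac (\<beta> s j) * z j) ^ t s)) = 0"
      by (elim exE conjE)
    \<comment> \<open>Positions among the rows of the face are translated back to rows of \<open>P\<close> along \<open>\<rho>\<close>.\<close>
    define e where "e t = (\<Sum>s<m. Poly_Mapping.single (\<rho> s) (int (t s)))" for t :: "nat \<Rightarrow> nat"
    have lke: "Poly_Mapping.lookup (e t) (\<rho> s) = int (t s)" if "s < m" for t s
    proof -
      have "Poly_Mapping.lookup (e t) (\<rho> s) = (\<Sum>s'<m. int (t s') when s' = s)"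
        using \<rho>inj that by (auto simp: e_def lookup_sum lookup_single inj_on_eq_iff intro!: sum.cong)
      then show ?thesis using that by (simp add: when_def)
    qed
    have lke0: "Poly_Mapping.lookup (e t) i = 0" if "i \<notin> I" for t i
      using that bij_betwE[OF \<rho>] by (auto simp: e_def lookup_sum lookup_single when_def intro!: sum.neutral)
    have einj: "inj_on e F"
    proof (rule inj_onI)
      fix t t' assume t: "t \<in> F" "t' \<in> F" "e t = e t'"
      show "t = t'"
      proof (rule PiE_ext)
        show "t \<in> {..<m} \<rightarrow>\<^sub>E UNIV" "t' \<in> {..<m} \<rightarrow>\<^sub>E UNIV" using t F(2) by auto
        show "t s = t' s" if "s \<in> {..<m}" for s using lke[of s t] lke[of s t'] t(3) that by simp
      qed
    qed
    define h where "h = (\<Sum>t\<in>F. Poly_Mapping.single (e t) (c t))"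
    have lkh: "Poly_Mapping.lookup h (e t) = c t" if "t \<in> F" for t
    proof -
      have "Poly_Mapping.lookup h (e t) = (\<Sum>t'\<in>F. c t' when t' = t)"
        using einj that by (auto simp: h_def lookup_sum lookup_single inj_on_eq_iff intro!: sum.cong)
      then show ?thesis using that F(1) by (simp add: when_def)
    qed
    have keys: "Poly_Mapping.keys h \<subseteq> e ` F"
      using Poly_Mapping.keys_sum[of "\<lambda>t. Poly_Mapping.single (e t) (c t)" F]
      by (fastforce simp: h_def split: if_splits)
    have keyse: "Poly_Mapping.keys (e t) \<subseteq> {..<n}" for t
      using lke0[of _ t] I(2) by (auto simp: in_keys_iff)
    show ?thesis
    proof (intro exI conjI ballI impI)
      show "h \<in> carrier (laurent_ring n)"
        using keys keyse by (auto simp: laurent_ring_def dest!: subsetD)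
      show "h \<noteq> 0" using F(3) lkh by auto
    next
      have "pullback_exponent P (e t) = pullback_exponent P (e t')" if t: "t \<in> F" "t' \<in> F" for t t'
      proof (rule poly_mapping_eqI)
        fix j
        have "Poly_Mapping.lookup (pullback_exponent P (e t)) j = (\<Sum>s<m. int (t s) * p s j)" for t
        proof (cases "j < N")
          case True
          have "(\<Sum>i<n. Poly_Mapping.lookup (e t) i * P $$ (i, j)) = (\<Sum>i\<in>I. Poly_Mapping.lookup (e t) i * P $$ (i, j))"
            using I(2) lke0 by (intro sum.mono_neutral_right) auto
          also have "\<dots> = (\<Sum>s<m. Poly_Mapping.lookup (e t) (\<rho> s) * P $$ (\<rho> s, j))"
            by (rule sum.reindex_bij_betw[OF \<rho>, symmetric])
          also have "\<dots> = (\<Sum>s<m. int (t s) * p s j)" using True by (simp add: lke p)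
          finally show ?thesis using True by (simp add: lookup_pullback_exponent dims)
        qed (simp add: lookup_pullback_exponent dims p)
        then show "Poly_Mapping.lookup (pullback_exponent P (e t)) j =
            Poly_Mapping.lookup (pullback_exponent P (e t')) j"
          using iso t by metis
      qed
      then show "pullback_exponent P u = pullback_exponent P u'"
        if "u \<in> Poly_Mapping.keys h" "u' \<in> Poly_Mapping.keys h" for u u'
        using that keys by blast
    next
      fix a :: "'q alg_closure Matrix.vec"
      assume a: "a \<in> torus_points n" and ha: "laurent_eval a (Poly_Mapping.map to_ac h) \<noteq> 0"
      have da: "dim_vec a = n" using a by (auto simp: torus_points_def)
      show "\<not> (\<exists>x\<in>torus_points N. \<forall>j<N. laurent_eval x (laurent_deriv j (face_laurent P a \<tau>)) = 0)"
      proof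
        assume "\<exists>x\<in>torus_points N. \<forall>j<N. laurent_eval x (laurent_deriv j (face_laurent P a \<tau>)) = 0"
        then obtain x where x: "x \<in> torus_points N"
          "\<forall>j<N. laurent_eval x (laurent_deriv j (face_laurent P a \<tau>)) = 0" by blast
        have x0: "x $ j \<noteq> 0" if "j < N" for j using x(1) that by (auto simp: torus_points_def)
        obtain t0 where t0: "t0 \<in> F" using F(3) by blast
        \<comment> \<open>The factor \<open>x\<^sup>w\<close> that all monomials of the relation have in common.\<close>
        define W where "W = (\<Prod>j<N. x $ j powi (\<Sum>s<m. int (t0 s) * p s j))"
        have W0: "W \<noteq> 0" using x0 by (auto simp: W_def)
        have \<xi>W: "(\<Prod>s<m. \<xi> x s ^ t s) = W" if t: "t \<in> F" for t
        proof -
          have "(\<Prod>s<m. \<xi> x s ^ t s) = (\<Prod>s<m. \<Prod>j<N. x $ j powi (int (t s) * p s j))"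
            by (simp add: \<xi>_def prod_power_distrib power_int_mult mult.commute[of "int _"])
          also have "\<dots> = (\<Prod>j<N. \<Prod>s<m. x $ j powi (int (t s) * p s j))" by (rule prod.swap)
          also have "\<dots> = (\<Prod>j<N. x $ j powi (\<Sum>s<m. int (t s) * p s j))"
            by (intro prod.cong) (simp_all add: power_int_sum x0)
          also have "\<dots> = W"
            unfolding W_def using iso t t0 by (intro prod.cong refl arg_cong[where f = "power_int _"]) blast
          finally show ?thesis .
        qed
        have mon: "(\<Prod>j<n. a $ j powi Poly_Mapping.lookup (e t) j) = (\<Prod>s<m. a $ \<rho> s ^ t s)" for t
        proof -
          have "(\<Prod>j<n. a $ j powi Poly_Mapping.lookup (e t) j) = (\<Prod>j\<in>I. a $ j powi Poly_Mapping.lookup (e t) j)"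
            using I(2) lke0 by (intro prod.mono_neutral_right) auto
          also have "\<dots> = (\<Prod>s<m. a $ \<rho> s powi Poly_Mapping.lookup (e t) (\<rho> s))"
            by (rule prod.reindex_bij_betw[OF \<rho>, symmetric])
          finally show ?thesis by (simp add: lke)
        qed
        have "0 = (\<Sum>t\<in>F. to_ac (c t) * (\<Prod>s<m. (a $ \<rho> s * \<xi> x s) ^ t s))"
          using rel[THEN spec, of "\<lambda>j. a $ \<rho> j * \<xi> x j"] critical[OF x] by simp
        also have "\<dots> = (\<Sum>t\<in>F. W * (to_ac (c t) * (\<Prod>s<m. a $ \<rho> s ^ t s)))"
          by (intro sum.cong) (simp_all add: power_mult_distrib prod.distrib \<xi>W mult_ac)
        also have "\<dots> = W * laurent_eval a (Poly_Mapping.map to_ac h)"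
          by (simp add: h_def map_to_ac_sum_single laurent_eval_sum laurent_eval_single da mon sum_distrib_left)
        finally show False using W0 ha by simp
      qed
    qed
  qed
qed

section \<open>Generic non-degeneracy\<close>

theorem theorem3:
  fixes A Q P D :: "int mat" and r n k :: nat
  defines "P1 \<equiv> first_cols k P"
    and "P0 \<equiv> drop_cols k P"
  defines "\<Delta> \<equiv> row_polytope P0"
  assumes "A \<in> carrier_mat r n"
    and "mat_rank (map_mat rat_of_int A) = k"
    and "Q \<in> carrier_mat r r" and "invertible_mat Q"
    and "P \<in> carrier_mat n n" and "invertible_mat P"
    and "Q * A * P = D"
    and "is_smith_normal_form D"
    and "\<And>i. i < min r n \<Longrightarrow> D $$ (i, i) \<noteq> 0 \<longleftrightarrow> i < k"
    and "\<And>\<tau>. \<tau> \<in> faces_off_origin \<Delta> \<Longrightarrow>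
           mat_rank (map_mat (of_int :: int \<Rightarrow> 'q::{field,finite}) (submatrix P0 (rows_in P0 \<tau>) UNIV))
             = affine_dimension \<tau> + 1"
  shows "\<exists>U :: 'q laurent set set.
           dense_openin (torus n) U \<and>
           (\<forall>a \<in> geometric_points n U. nondegenerate P0 \<Delta> a) \<and>
           (let V = {I \<in> topspace (torus k). torus_hom P1 I \<in> U}
            in V \<noteq> {} \<and> dense_openin (torus k) V)"
proof -
  let ?R = "\<lambda>n. laurent_ring n :: 'q laurent ring"
  have P: "P \<in> carrier_mat n n" and inv: "invertible_mat P" by fact+
  have kn: "k \<le> n"
    using vec_space.rank_le_nc[of "map_mat rat_of_int A" r n] assms(4,5) by (auto simp: mat_rank_def)
  have P0: "P0 \<in> carrier_mat n (n - k)" using P by (auto simp: P0_def drop_cols_def)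
  have P1: "dim_row P1 = n" "dim_col P1 = k" using P by (auto simp: P1_def first_cols_def)
  have dom: "domain (?R i)" and cr: "cring (?R i)" for i
    using domain_laurent_ring by (auto simp: domain_def)
  have zero: "\<zero>\<^bsub>?R i\<^esub> = 0" for i by (simp add: laurent_ring_def)
  \<comment> \<open>A face enters the condition only through the set of rows in it, and there are finitely many of these.\<close>
  define good where "good I h \<longleftrightarrow> h \<in> carrier (?R n) \<and> torus_comorphism P1 h \<noteq> 0 \<and>
    (\<forall>\<tau> a. \<tau> \<in> faces_off_origin \<Delta> \<longrightarrow> rows_in P0 \<tau> = I \<longrightarrow> a \<in> torus_points n \<longrightarrow>
      laurent_eval a (Poly_Mapping.map to_ac h) \<noteq> 0 \<longrightarrow>
      \<not> (\<exists>x\<in>torus_points (dim_col P0). \<forall>j<dim_col P0. laurent_eval x (laurent_deriv j (face_laurent P0 a \<tau>)) = 0))"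
    for I and h :: "'q laurent"
  define \<I> where "\<I> = rows_in P0 ` faces_off_origin \<Delta>"
  have "\<I> \<subseteq> Pow {..<n}" using P0 by (auto simp: \<I>_def rows_in_def)
  then have fin: "finite \<I>" by (rule finite_subset) simp
  have "\<exists>h. good I h" if I: "I \<in> \<I>" for I
  proof -
    obtain \<tau> where \<tau>: "\<tau> \<in> faces_off_origin \<Delta>" "I = rows_in P0 \<tau>" using I by (auto simp: \<I>_def)
    obtain h :: "'q laurent" where h: "h \<in> carrier (?R n)" "h \<noteq> 0"
      "\<forall>e\<in>Poly_Mapping.keys h. \<forall>e'\<in>Poly_Mapping.keys h. pullback_exponent P0 e = pullback_exponent P0 e'"
      "\<forall>a\<in>torus_points n. laurent_eval a (Poly_Mapping.map to_ac h) \<noteq> 0 \<longrightarrow>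
      \<not> (\<exists>x\<in>torus_points (n - k). \<forall>j<n - k. laurent_eval x (laurent_deriv j (face_laurent P0 a \<tau>)) = 0)"
      using ex_isobaric_equation[OF P0 _ assms(13)[OF \<tau>(1)]] \<tau>(1) unfolding \<Delta>_def by blast
    have "inj_on (pullback_exponent P1) (Poly_Mapping.keys h)"
      unfolding P1_def
    proof (rule inj_on_pullback_exponent_first_cols[OF P inv kn])
      show "Poly_Mapping.keys e \<subseteq> {..<n}" if "e \<in> Poly_Mapping.keys h" for e
        using h(1) that by (simp add: laurent_ring_def)
      show "pullback_exponent (drop_cols k P) e = pullback_exponent (drop_cols k P) e'"
        if "e \<in> Poly_Mapping.keys h" "e' \<in> Poly_Mapping.keys h" for e e'
        using h(3) that unfolding P0_def by blast
    qed
    then have "torus_comorphism P1 h \<noteq> 0" using h(2) by (rule torus_comorphism_nonzero)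
    moreover have "face_laurent P0 a \<tau>' = face_laurent P0 a \<tau>"
      if "rows_in P0 \<tau>' = I" for \<tau>' and a :: "'q alg_closure Matrix.vec"
      using that \<tau>(2) by (simp add: face_laurent_def)
    ultimately show ?thesis using h(1,4) P0 unfolding good_def by (intro exI[of _ h]) auto
  qed
  then obtain hh where hh: "\<And>I. I \<in> \<I> \<Longrightarrow> good I (hh I)" by metis
  define H where "H = hh ` \<I>"
  define U where "U = {I \<in> prime_spectrum (?R n). \<forall>h\<in>H. h \<notin> I}"
  have H: "finite H" "H \<subseteq> carrier (?R n)" "\<And>h. h \<in> H \<Longrightarrow> torus_comorphism P1 h \<noteq> 0"
    using fin hh by (auto simp: H_def good_def)
  have dense: "dense_openin (torus i) {I \<in> prime_spectrum (?R i). \<forall>h\<in>K. h \<notin> I} \<and>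
      {I \<in> prime_spectrum (?R i). \<forall>h\<in>K. h \<notin> I} \<noteq> {}"
    if K: "finite K" "K \<subseteq> carrier (?R i)" "0 \<notin> K" for K i
  proof -
    \<comment> \<open>The generic point.\<close>
    have "{0} \<in> {I \<in> prime_spectrum (?R i). \<forall>h\<in>K. h \<notin> I}"
      using domain.zeroprimeideal[OF dom[of i]] K(3) by (auto simp: prime_spectrum_def zero)
    then show ?thesis
      using dense_openin_zariski[OF dom openin_finite_nonvanishing[OF cr K(1,2)]]
      unfolding torus_def by blast
  qed
  have "0 \<notin> H" using H(3) torus_comorphism_zero by blast
  then have U: "dense_openin (torus n) U" unfolding U_def using dense H(1,2) by blast
  have nondeg: "nondegenerate P0 \<Delta> a" if a: "a \<in> geometric_points n U" for a
    unfolding nondegenerate_def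
  proof
    fix \<tau> assume \<tau>: "\<tau> \<in> faces_off_origin \<Delta>"
    then have I: "rows_in P0 \<tau> \<in> \<I>" by (simp add: \<I>_def)
    have at: "a \<in> torus_points n" and "geometric_point_ideal a \<in> U"
      using a by (auto simp: geometric_points_def)
    then have "hh (rows_in P0 \<tau>) \<notin> geometric_point_ideal a" using I by (auto simp: U_def H_def)
    moreover have "dim_vec a = n" using at by (auto simp: torus_points_def)
    ultimately have "laurent_eval a (Poly_Mapping.map to_ac (hh (rows_in P0 \<tau>))) \<noteq> 0"
      using hh[OF I] by (auto simp: geometric_point_ideal_def good_def)
    then show "\<not> (\<exists>x\<in>torus_points (dim_col P0).
        \<forall>j<dim_col P0. laurent_eval x (laurent_deriv j (face_laurent P0 a \<tau>)) = 0)"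
      using hh[OF I] \<tau> at unfolding good_def by blast
  qed
  have "{I \<in> topspace (torus k). torus_hom P1 I \<in> U} =
      {I \<in> prime_spectrum (?R k). \<forall>h\<in>torus_comorphism P1 ` H. h \<notin> I}"
    using torus_hom_in_spectrum[of _ P1] H(2) P1 topspace_zariski_topology[OF cr[of k]]
    by (auto simp: U_def torus_def torus_hom_def)
  moreover have "torus_comorphism P1 ` H \<subseteq> carrier (?R k)"
    using torus_comorphism_closed[of P1] P1(2) by auto
  moreover have "0 \<notin> torus_comorphism P1 ` H" using H(3) by force
  ultimately show ?thesis
    using U nondeg dense[of "torus_comorphism P1 ` H" k] H(1) by (intro exI[of _ U]) (simp add: Let_def)
qed

end
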